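(* Let $R$ be a (commutative) principal ideal domain, $\sigma\in\mathrm{Aut}(R)$, $0\ne a\in R$, and $A=R(\sigma,a)$ the corresponding generalized Weyl algebra. Assume that all $\mathcal G$-orbits in $\mathrm{Irr}(R)$ are infinite and let $\mathsf p$ be a divisor of $a$. Then $V_{\mathsf p}$ has a unique simple submodule $$\mathrm{Soc}(V_{\mathsf p})\simeq V_{\hat{\mathsf p}},$$ where $\hat{\mathsf p}$ is the divisor of $a$ produced from $\mathsf p$ by the (terminating) switching procedure described in the context.
   Context: Modules are left and unital. The generalized Weyl algebra $R(\sigma,a)$ is the ring generated by $R$, $x$, $y$ subject to $x\sigma(r)=rx$, $yr=\sigma(r)y$ for all $r\in R$, $xy=a$, $yx=\sigma(a)$. For a divisor $\mathsf p$ of $a$ and $\mathsf q=\sigma(a/\mathsf p)$, the $A$-module $V_{\mathsf p}$ is $R$ as an abelian group, with $r'\cdot r=r'r$, $x\cdot r=\sigma^{-1}(r)\mathsf p$, $y\cdot r=\sigma(r)\mathsf q$. $\mathrm{Soc}$ denotes the socle. $[r]$ is the class of $r$ up to associates; $\mathrm{Irr}(R)$ is the set of classes of irreducible elements, on which $\mathcal G=\langle\sigma\rangle\le\mathrm{Aut}(R)$ acts; $\mathrm{Irr}(r)$ is the multiset of classes of irreducible factors of $r\neq0$. Write $[r]\preccurlyeq[s]$ iff $[\sigma^n(r)]=[s]$ for some $n\ge0$, and $\Omega_{\mathsf p}=\{(z,w)\in\mathrm{Irr}(\mathsf q)\times\mathrm{Irr}(\mathsf p)\mid z\preccurlyeq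 w\}$. Switching procedure: start with the pair $(\mathsf p,\mathsf q)$, $\mathsf q=\sigma(a/\mathsf p)$. If $\Omega_{\mathsf p}=\varnothing$, stop and output $\hat{\mathsf p}=\mathsf p$. Otherwise pick irreducible factors $\mathsf q_0\mid\mathsf q$ and $\mathsf p_0\mid\mathsf p$ with $\mathsf p_0=\sigma^n(\mathsf q_0)$ for some $n\ge0$, such that there are no $0\le i\le j\le n$ with $j-i<n$, $[\sigma^i(\mathsf q_0)]\in\mathrm{Irr}(\mathsf q)$ and $[\sigma^j(\mathsf q_0)]\in\mathrm{Irr}(\mathsf p)$. Replace $\mathsf p$ by $\mathsf p'=\sigma^{-1}(\mathsf q_0)\frac{\mathsf p}{\mathsf p_0}$ and $\mathsf q$ by $\mathsf q'=\sigma(\mathsf p_0)\frac{\mathsf q}{\mathsf q_0}$ (again $\mathsf q'=\sigma(a/\mathsf p')$), and repeat. *)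

theory Defs
  imports "HOL-Algebra.Ring_Divisibility" "HOL-Algebra.Module"
begin

section \<open>Left modules over a not necessarily commutative ring\<close>

text \<open>
  The locale \<^locale>\<open>module\<close> of HOL-Algebra requires a commutative ring of scalars. The record type
  of modules and the locale \<^locale>\<open>submodule\<close> do not, and are reused here.
\<close>

locale left_module = R?: ring R + M?: abelian_group M
  for R :: "('a, 'm) ring_scheme" (structure) and M :: "('a, 'b, 'n) module_scheme" (structure) +
  assumes lm_closed [simp, intro]:
      "\<lbrakk>r \<in> carrier R; x \<in> carrier M\<rbrakk> \<Longrightarrow> r \<odot>\<^bsub>M\<^esub> x \<in> carrier M"
    and lm_l_distr:
      "\<lbrakk>r \<in> carrier R; s \<in> carrier R; x \<in> carrier M\<rbrakk> \<Longrightarrow>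
        (r \<oplus>\<^bsub>R\<^esub> s) \<odot>\<^bsub>M\<^esub> x = r \<odot>\<^bsub>M\<^esub> x \<oplus>\<^bsub>M\<^esub> s \<odot>\<^bsub>M\<^esub> x"
    and lm_r_distr:
      "\<lbrakk>r \<in> carrier R; x \<in> carrier M; y \<in> carrier M\<rbrakk> \<Longrightarrow>
        r \<odot>\<^bsub>M\<^esub> (x \<oplus>\<^bsub>M\<^esub> y) = r \<odot>\<^bsub>M\<^esub> x \<oplus>\<^bsub>M\<^esub> r \<odot>\<^bsub>M\<^esub> y"
    and lm_assoc:
      "\<lbrakk>r \<in> carrier R; s \<in> carrier R; x \<in> carrier M\<rbrakk> \<Longrightarrow>
        (r \<otimes>\<^bsub>R\<^esub> s) \<odot>\<^bsub>M\<^esub> x = r \<odot>\<^bsub>M\<^esub> (s \<odot>\<^bsub>M\<^esub> x)"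
    and lm_one [simp]:
      "x \<in> carrier M \<Longrightarrow> \<one>\<^bsub>R\<^esub> \<odot>\<^bsub>M\<^esub> x = x"

definition simple_module ::
    "('a, 'm) ring_scheme \<Rightarrow> ('a, 'b) module \<Rightarrow> bool" where
  "simple_module A M \<longleftrightarrow>
     left_module A M \<and> carrier M \<noteq> {\<zero>\<^bsub>M\<^esub>} \<and>
     (\<forall>N. submodule N A M \<longrightarrow> N = {\<zero>\<^bsub>M\<^esub>} \<or> N = carrier M)"

definition simple_submodule ::
    "('a, 'm) ring_scheme \<Rightarrow> ('a, 'b) module \<Rightarrow> 'b set \<Rightarrow> bool" where
  "simple_submodule A M S \<longleftrightarrow> submodule S A M \<and> simple_module A (M\<lparr>carrier := S\<rparr>)"

text \<open>The sum of all simple submodules, as the least submodule containing each of them.\<close>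

definition socle :: "('a, 'm) ring_scheme \<Rightarrow> ('a, 'b) module \<Rightarrow> 'b set" where
  "socle A M = \<Inter> {N. submodule N A M \<and> (\<forall>S. simple_submodule A M S \<longrightarrow> S \<subseteq> N)}"

definition module_iso ::
    "('a, 'm) ring_scheme \<Rightarrow> ('a, 'b) module \<Rightarrow> ('a, 'c) module \<Rightarrow> ('b \<Rightarrow> 'c) set" where
  "module_iso A M N = {f. bij_betw f (carrier M) (carrier N) \<and>
     (\<forall>x\<in>carrier M. \<forall>y\<in>carrier M. f (x \<oplus>\<^bsub>M\<^esub> y) = f x \<oplus>\<^bsub>N\<^esub> f y) \<and>
     (\<forall>r\<in>carrier A. \<forall>x\<in>carrier M. f (r \<odot>\<^bsub>M\<^esub> x) = r \<odot>\<^bsub>N\<^esub> f x)}"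

definition module_isomorphic ::
    "('a, 'm) ring_scheme \<Rightarrow> ('a, 'b) module \<Rightarrow> ('a, 'c) module \<Rightarrow> bool" where
  "module_isomorphic A M N \<longleftrightarrow> module_iso A M N \<noteq> {}"


section \<open>Generalized Weyl algebras\<close>

text \<open>
  The ring generated by \<open>R\<close>, \<open>x\<close>, \<open>y\<close> subject to the defining relations: ring expressions in the
  elements of \<open>R\<close> and two further symbols, modulo the least congruence that contains the ring axioms,
  the operations of \<open>R\<close>, and the relations.
\<close>

datatype (coefs: 'a) gwa_term =
    Coef 'a | GenX | GenY
  | Add "'a gwa_term" "'a gwa_term"
  | Neg "'a gwa_term"
  | Mul "'a gwa_term" "'a gwa_term"

definition gwa_terms :: "('a, 'm) ring_scheme \<Rightarrow> 'a gwa_term set" where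
  "gwa_terms R = {t. coefs t \<subseteq> carrier R}"

inductive gwa_cong ::
    "('a, 'm) ring_scheme \<Rightarrow> ('a \<Rightarrow> 'a) \<Rightarrow> 'a \<Rightarrow> 'a gwa_term \<Rightarrow> 'a gwa_term \<Rightarrow> bool"
  for R \<sigma> a where
  refl: "s \<in> gwa_terms R \<Longrightarrow> gwa_cong R \<sigma> a s s"
| sym: "gwa_cong R \<sigma> a s t \<Longrightarrow> gwa_cong R \<sigma> a t s"
| trans: "\<lbrakk>gwa_cong R \<sigma> a s t; gwa_cong R \<sigma> a t u\<rbrakk> \<Longrightarrow> gwa_cong R \<sigma> a s u"
| add: "\<lbrakk>gwa_cong R \<sigma> a s s'; gwa_cong R \<sigma> a t t'\<rbrakk> \<Longrightarrow> gwa_cong R \<sigma> a (Add s t) (Add s' t')"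
| neg: "gwa_cong R \<sigma> a s s' \<Longrightarrow> gwa_cong R \<sigma> a (Neg s) (Neg s')"
| mul: "\<lbrakk>gwa_cong R \<sigma> a s s'; gwa_cong R \<sigma> a t t'\<rbrakk> \<Longrightarrow> gwa_cong R \<sigma> a (Mul s t) (Mul s' t')"
| add_assoc: "\<lbrakk>s \<in> gwa_terms R; t \<in> gwa_terms R; u \<in> gwa_terms R\<rbrakk> \<Longrightarrow>
    gwa_cong R \<sigma> a (Add (Add s t) u) (Add s (Add t u))"
| add_comm: "\<lbrakk>s \<in> gwa_terms R; t \<in> gwa_terms R\<rbrakk> \<Longrightarrow> gwa_cong R \<sigma> a (Add s t) (Add t s)"
| add_zero: "s \<in> gwa_terms R \<Longrightarrow> gwa_cong R \<sigma> a (Add (Coef \<zero>\<^bsub>R\<^esub>) s) s"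
| add_neg: "s \<in> gwa_terms R \<Longrightarrow> gwa_cong R \<sigma> a (Add (Neg s) s) (Coef \<zero>\<^bsub>R\<^esub>)"
| mul_assoc: "\<lbrakk>s \<in> gwa_terms R; t \<in> gwa_terms R; u \<in> gwa_terms R\<rbrakk> \<Longrightarrow>
    gwa_cong R \<sigma> a (Mul (Mul s t) u) (Mul s (Mul t u))"
| one_mul: "s \<in> gwa_terms R \<Longrightarrow> gwa_cong R \<sigma> a (Mul (Coef \<one>\<^bsub>R\<^esub>) s) s"
| mul_one: "s \<in> gwa_terms R \<Longrightarrow> gwa_cong R \<sigma> a (Mul s (Coef \<one>\<^bsub>R\<^esub>)) s"
| l_distr: "\<lbrakk>s \<in> gwa_terms R; t \<in> gwa_terms R; u \<in> gwa_terms R\<rbrakk> \<Longrightarrow>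
    gwa_cong R \<sigma> a (Mul (Add s t) u) (Add (Mul s u) (Mul t u))"
| r_distr: "\<lbrakk>s \<in> gwa_terms R; t \<in> gwa_terms R; u \<in> gwa_terms R\<rbrakk> \<Longrightarrow>
    gwa_cong R \<sigma> a (Mul u (Add s t)) (Add (Mul u s) (Mul u t))"
| coef_add: "\<lbrakk>r \<in> carrier R; r' \<in> carrier R\<rbrakk> \<Longrightarrow>
    gwa_cong R \<sigma> a (Coef (r \<oplus>\<^bsub>R\<^esub> r')) (Add (Coef r) (Coef r'))"
| coef_mul: "\<lbrakk>r \<in> carrier R; r' \<in> carrier R\<rbrakk> \<Longrightarrow>
    gwa_cong R \<sigma> a (Coef (r \<otimes>\<^bsub>R\<^esub> r')) (Mul (Coef r) (Coef r'))"
| rel_X: "r \<in> carrier R \<Longrightarrow> gwa_cong R \<sigma> a (Mul GenX (Coef (\<sigma> r))) (Mul (Coef r) GenX)"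
| rel_Y: "r \<in> carrier R \<Longrightarrow> gwa_cong R \<sigma> a (Mul GenY (Coef r)) (Mul (Coef (\<sigma> r)) GenY)"
| rel_XY: "gwa_cong R \<sigma> a (Mul GenX GenY) (Coef a)"
| rel_YX: "gwa_cong R \<sigma> a (Mul GenY GenX) (Coef (\<sigma> a))"

definition gwa_rel ::
    "('a, 'm) ring_scheme \<Rightarrow> ('a \<Rightarrow> 'a) \<Rightarrow> 'a \<Rightarrow> ('a gwa_term \<times> 'a gwa_term) set" where
  "gwa_rel R \<sigma> a = {(s, t). gwa_cong R \<sigma> a s t}"

definition gwa_class ::
    "('a, 'm) ring_scheme \<Rightarrow> ('a \<Rightarrow> 'a) \<Rightarrow> 'a \<Rightarrow> 'a gwa_term \<Rightarrow> 'a gwa_term set" where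
  "gwa_class R \<sigma> a t = gwa_rel R \<sigma> a `` {t}"

definition gwa ::
    "('a, 'm) ring_scheme \<Rightarrow> ('a \<Rightarrow> 'a) \<Rightarrow> 'a \<Rightarrow> 'a gwa_term set ring" where
  "gwa R \<sigma> a =
    \<lparr>carrier = gwa_terms R // gwa_rel R \<sigma> a,
     mult = (\<lambda>S T. \<Union>s\<in>S. \<Union>t\<in>T. gwa_class R \<sigma> a (Mul s t)),
     one = gwa_class R \<sigma> a (Coef \<one>\<^bsub>R\<^esub>),
     zero = gwa_class R \<sigma> a (Coef \<zero>\<^bsub>R\<^esub>),
     add = (\<lambda>S T. \<Union>s\<in>S. \<Union>t\<in>T. gwa_class R \<sigma> a (Add s t))\<rparr>"


section \<open>The modules attached to the divisors of a\<close>

text \<open>The quotient \<open>r / s\<close> of a domain, for a nonzero divisor \<open>s\<close> of \<open>r\<close>.\<close>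

definition quo :: "('a, 'm) ring_scheme \<Rightarrow> 'a \<Rightarrow> 'a \<Rightarrow> 'a" where
  "quo R r s = (THE c. c \<in> carrier R \<and> r = s \<otimes>\<^bsub>R\<^esub> c)"

primrec gwa_act ::
    "('a, 'm) ring_scheme \<Rightarrow> ('a \<Rightarrow> 'a) \<Rightarrow> 'a \<Rightarrow> 'a \<Rightarrow> 'a gwa_term \<Rightarrow> 'a \<Rightarrow> 'a" where
  "gwa_act R \<sigma> p q (Coef r') r = r' \<otimes>\<^bsub>R\<^esub> r"
| "gwa_act R \<sigma> p q GenX r = inv_into (carrier R) \<sigma> r \<otimes>\<^bsub>R\<^esub> p"
| "gwa_act R \<sigma> p q GenY r = \<sigma> r \<otimes>\<^bsub>R\<^esub> q"
| "gwa_act R \<sigma> p q (Add s t) r = gwa_act R \<sigma> p q s r \<oplus>\<^bsub>R\<^esub> gwa_act R \<sigma> p q t r"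
| "gwa_act R \<sigma> p q (Neg s) r = \<ominus>\<^bsub>R\<^esub> gwa_act R \<sigma> p q s r"
| "gwa_act R \<sigma> p q (Mul s t) r = gwa_act R \<sigma> p q s (gwa_act R \<sigma> p q t r)"

text \<open>
  The module \<open>V\<^sub>p\<close>. The choice of a representative in the scalar multiplication is immaterial, see
  \<open>Vmod_smult\<close> below. Modules are records extending rings; the fields \<open>mult\<close> and \<open>one\<close>
  play no role.
\<close>

definition Vmod ::
    "('a, 'm) ring_scheme \<Rightarrow> ('a \<Rightarrow> 'a) \<Rightarrow> 'a \<Rightarrow> 'a \<Rightarrow> ('a gwa_term set, 'a) module" where
  "Vmod R \<sigma> a p =
    \<lparr>carrier = carrier R, mult = mult R, one = one R, zero = zero R, add = add R,
     smult = (\<lambda>T. gwa_act R \<sigma> p (\<sigma> (quo R a p)) (SOME t. t \<in> T))\<rparr>"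


section \<open>Classes of irreducible elements and the switching procedure\<close>

text \<open>The class \<open>[r]\<close> of associates of \<open>r\<close> is \<^term>\<open>assocs R r\<close>.\<close>

definition Irr :: "('a, 'm) ring_scheme \<Rightarrow> 'a set set" where
  "Irr R = {assocs R r | r. r \<in> carrier R \<and> ring_irreducible\<^bsub>R\<^esub> r}"

text \<open>
  Only membership in the multiset of classes of irreducible factors of \<open>r\<close> is ever used, so
  multiplicities are not recorded.
\<close>

definition Irr_of :: "('a, 'm) ring_scheme \<Rightarrow> 'a \<Rightarrow> 'a set set" where
  "Irr_of R r = {assocs R c | c. c \<in> carrier R \<and> ring_irreducible\<^bsub>R\<^esub> c \<and> c divides\<^bsub>R\<^esub> r}"

definition aut_pow :: "('a, 'm) ring_scheme \<Rightarrow> ('a \<Rightarrow> 'a) \<Rightarrow> int \<Rightarrow> 'a \<Rightarrow> 'a" where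
  "aut_pow R \<sigma> k = (if 0 \<le> k then \<sigma> ^^ nat k else inv_into (carrier R) \<sigma> ^^ nat (- k))"

text \<open>The orbit of a class \<open>z\<close> under the group of all integer powers of \<open>\<sigma>\<close>.\<close>

definition aut_orbit :: "('a, 'm) ring_scheme \<Rightarrow> ('a \<Rightarrow> 'a) \<Rightarrow> 'a set \<Rightarrow> 'a set set" where
  "aut_orbit R \<sigma> z = {aut_pow R \<sigma> k ` z | k. True}"

definition prec :: "('a, 'm) ring_scheme \<Rightarrow> ('a \<Rightarrow> 'a) \<Rightarrow> 'a set \<Rightarrow> 'a set \<Rightarrow> bool" where
  "prec R \<sigma> z w \<longleftrightarrow>
    (\<exists>r\<in>carrier R. \<exists>s\<in>carrier R. z = assocs R r \<and> w = assocs R s \<and>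
      (\<exists>n. assocs R ((\<sigma> ^^ n) r) = assocs R s))"

definition Omega ::
    "('a, 'm) ring_scheme \<Rightarrow> ('a \<Rightarrow> 'a) \<Rightarrow> 'a \<times> 'a \<Rightarrow> ('a set \<times> 'a set) set" where
  "Omega R \<sigma> = (\<lambda>(p, q). {(z, w) \<in> Irr_of R q \<times> Irr_of R p. prec R \<sigma> z w})"

text \<open>
  One round of the procedure, as a relation on the pairs \<open>(p, q)\<close>; it is not a function because the
  factors \<open>q\<^sub>0\<close> and \<open>p\<^sub>0\<close> are chosen freely.
\<close>

definition switch_step ::
    "('a, 'm) ring_scheme \<Rightarrow> ('a \<Rightarrow> 'a) \<Rightarrow> 'a \<times> 'a \<Rightarrow> 'a \<times> 'a \<Rightarrow> bool" where
  "switch_step R \<sigma> = (\<lambda>(p, q) (p', q').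
    Omega R \<sigma> (p, q) \<noteq> {} \<and>
    (\<exists>q\<^sub>0\<in>carrier R. \<exists>p\<^sub>0\<in>carrier R. \<exists>n.
      ring_irreducible\<^bsub>R\<^esub> q\<^sub>0 \<and> q\<^sub>0 divides\<^bsub>R\<^esub> q \<and>
      ring_irreducible\<^bsub>R\<^esub> p\<^sub>0 \<and> p\<^sub>0 divides\<^bsub>R\<^esub> p \<and>
      p\<^sub>0 = (\<sigma> ^^ n) q\<^sub>0 \<and>
      \<not> (\<exists>i j. i \<le> j \<and> j \<le> n \<and> j - i < n \<and>
            assocs R ((\<sigma> ^^ i) q\<^sub>0) \<in> Irr_of R q \<and> assocs R ((\<sigma> ^^ j) q\<^sub>0) \<in> Irr_of R p) \<and>
      p' = inv_into (carrier R) \<sigma> q\<^sub>0 \<otimes>\<^bsub>R\<^esub> quo R p p\<^sub>0 \<and>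
      q' = \<sigma> p\<^sub>0 \<otimes>\<^bsub>R\<^esub> quo R q q\<^sub>0))"

text \<open>
  Whatever choices are made, the procedure neither runs forever nor gets stuck without output, i.e.
  whenever a round is due, admissible factors exist.
\<close>

definition switching_terminates ::
    "('a, 'm) ring_scheme \<Rightarrow> ('a \<Rightarrow> 'a) \<Rightarrow> 'a \<Rightarrow> 'a \<Rightarrow> bool" where
  "switching_terminates R \<sigma> a p \<longleftrightarrow>
    \<not> (\<exists>f. f 0 = (p, \<sigma> (quo R a p)) \<and> (\<forall>i::nat. switch_step R \<sigma> (f i) (f (Suc i)))) \<and>
    (\<forall>st. (switch_step R \<sigma>)\<^sup>*\<^sup>* (p, \<sigma> (quo R a p)) st \<and> Omega R \<sigma> st \<noteq> {} \<longrightarrow>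
       (\<exists>st'. switch_step R \<sigma> st st'))"

definition switching_output ::
    "('a, 'm) ring_scheme \<Rightarrow> ('a \<Rightarrow> 'a) \<Rightarrow> 'a \<Rightarrow> 'a \<Rightarrow> 'a \<Rightarrow> bool" where
  "switching_output R \<sigma> a p p' \<longleftrightarrow>
    (\<exists>q'. (switch_step R \<sigma>)\<^sup>*\<^sup>* (p, \<sigma> (quo R a p)) (p', q') \<and> Omega R \<sigma> (p', q') = {})"


section \<open>The constructions are well-defined\<close>

lemma gwa_terms_simps [simp]:
  "Coef r \<in> gwa_terms R \<longleftrightarrow> r \<in> carrier R"
  "GenX \<in> gwa_terms R" "GenY \<in> gwa_terms R"
  "Add s t \<in> gwa_terms R \<longleftrightarrow> s \<in> gwa_terms R \<and> t \<in> gwa_terms R"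
  "Neg s \<in> gwa_terms R \<longleftrightarrow> s \<in> gwa_terms R"
  "Mul s t \<in> gwa_terms R \<longleftrightarrow> s \<in> gwa_terms R \<and> t \<in> gwa_terms R"
  by (auto simp: gwa_terms_def)

locale gwa_data = cring R for R :: "('a, 'm) ring_scheme" (structure) +
  fixes \<sigma> :: "'a \<Rightarrow> 'a" and a :: 'a
  assumes \<sigma>_iso: "\<sigma> \<in> ring_iso R R" and a_closed [simp]: "a \<in> carrier R"
begin

lemma \<sigma>_bij: "bij_betw \<sigma> (carrier R) (carrier R)"
  using ring_iso_memE(5)[OF \<sigma>_iso] .

lemma \<sigma>_closed [simp]: "r \<in> carrier R \<Longrightarrow> \<sigma> r \<in> carrier R"
  using ring_iso_memE(1)[OF \<sigma>_iso] .

lemma \<sigma>_mult [simp]: "\<lbrakk>r \<in> carrier R; s \<in> carrier R\<rbrakk> \<Longrightarrow> \<sigma> (r \<otimes> s) = \<sigma> r \<otimes> \<sigma> s"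
  using ring_iso_memE(2)[OF \<sigma>_iso] .

lemma \<sigma>_add [simp]: "\<lbrakk>r \<in> carrier R; s \<in> carrier R\<rbrakk> \<Longrightarrow> \<sigma> (r \<oplus> s) = \<sigma> r \<oplus> \<sigma> s"
  using ring_iso_memE(3)[OF \<sigma>_iso] .

abbreviation \<tau> :: "'a \<Rightarrow> 'a" where "\<tau> \<equiv> inv_into (carrier R) \<sigma>"

lemma \<tau>_closed [simp]: "r \<in> carrier R \<Longrightarrow> \<tau> r \<in> carrier R"
  using \<sigma>_bij by (metis bij_betw_imp_surj_on inv_into_into)

lemma \<sigma>_\<tau> [simp]: "r \<in> carrier R \<Longrightarrow> \<sigma> (\<tau> r) = r"
  using \<sigma>_bij by (metis bij_betw_inv_into_right)

lemma \<tau>_\<sigma> [simp]: "r \<in> carrier R \<Longrightarrow> \<tau> (\<sigma> r) = r"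
  using \<sigma>_bij by (metis bij_betw_inv_into_left)

lemma \<sigma>_inj: "\<lbrakk>r \<in> carrier R; s \<in> carrier R; \<sigma> r = \<sigma> s\<rbrakk> \<Longrightarrow> r = s"
  by (metis \<tau>_\<sigma>)

lemma \<tau>_mult [simp]: "\<lbrakk>r \<in> carrier R; s \<in> carrier R\<rbrakk> \<Longrightarrow> \<tau> (r \<otimes> s) = \<tau> r \<otimes> \<tau> s"
  by (rule \<sigma>_inj) auto

lemma \<tau>_add [simp]: "\<lbrakk>r \<in> carrier R; s \<in> carrier R\<rbrakk> \<Longrightarrow> \<tau> (r \<oplus> s) = \<tau> r \<oplus> \<tau> s"
  by (rule \<sigma>_inj) auto

lemma gwa_cong_terms: "gwa_cong R \<sigma> a s t \<Longrightarrow> s \<in> gwa_terms R \<and> t \<in> gwa_terms R"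
  by (induction rule: gwa_cong.induct) auto

lemma gwa_equiv: "equiv (gwa_terms R) (gwa_rel R \<sigma> a)"
proof (rule equivI)
  show "gwa_rel R \<sigma> a \<subseteq> gwa_terms R \<times> gwa_terms R"
    by (auto simp: gwa_rel_def dest: gwa_cong_terms)
  show "refl_on (gwa_terms R) (gwa_rel R \<sigma> a)"
    by (auto simp: gwa_rel_def refl_on_def gwa_cong.refl)
  show "sym (gwa_rel R \<sigma> a)"
    unfolding sym_def gwa_rel_def using gwa_cong.sym by fast
  show "trans (gwa_rel R \<sigma> a)"
    unfolding trans_def gwa_rel_def using gwa_cong.trans by fast
qed

abbreviation "cls \<equiv> gwa_class R \<sigma> a"

lemma cls_eq_iff:
  "\<lbrakk>s \<in> gwa_terms R; t \<in> gwa_terms R\<rbrakk> \<Longrightarrow> cls s = cls t \<longleftrightarrow> gwa_cong R \<sigma> a s t"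
  unfolding gwa_class_def using eq_equiv_class_iff[OF gwa_equiv, of s t]
  by (auto simp: gwa_rel_def)

lemma cls_eqI: "gwa_cong R \<sigma> a s t \<Longrightarrow> cls s = cls t"
  using cls_eq_iff gwa_cong_terms by blast

lemma mem_cls: "t \<in> cls s \<longleftrightarrow> gwa_cong R \<sigma> a s t"
  by (simp add: gwa_class_def gwa_rel_def)

lemma cls_self: "s \<in> gwa_terms R \<Longrightarrow> s \<in> cls s"
  by (simp add: mem_cls gwa_cong.refl)

lemma gwa_carrier: "carrier (gwa R \<sigma> a) = cls ` gwa_terms R"
  by (auto simp: gwa_def quotient_def gwa_class_def)

lemma cls_closed [simp]: "s \<in> gwa_terms R \<Longrightarrow> cls s \<in> carrier (gwa R \<sigma> a)"
  by (simp add: gwa_carrier)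

lemma gwa_add:
  assumes "s \<in> gwa_terms R" "t \<in> gwa_terms R"
  shows "cls s \<oplus>\<^bsub>gwa R \<sigma> a\<^esub> cls t = cls (Add s t)"
proof -
  have "cls (Add s' t') = cls (Add s t)" if "s' \<in> cls s" "t' \<in> cls t" for s' t'
    using that by (intro cls_eqI gwa_cong.sym[OF gwa_cong.add]) (simp_all add: mem_cls)
  then show ?thesis
    using cls_self[OF assms(1)] cls_self[OF assms(2)] unfolding gwa_def ring.simps monoid.simps by blast
qed

lemma gwa_mult:
  assumes "s \<in> gwa_terms R" "t \<in> gwa_terms R"
  shows "cls s \<otimes>\<^bsub>gwa R \<sigma> a\<^esub> cls t = cls (Mul s t)"
proof -
  have "cls (Mul s' t') = cls (Mul s t)" if "s' \<in> cls s" "t' \<in> cls t" for s' t'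
    using that by (intro cls_eqI gwa_cong.sym[OF gwa_cong.mul]) (simp_all add: mem_cls)
  then show ?thesis
    using cls_self[OF assms(1)] cls_self[OF assms(2)] unfolding gwa_def ring.simps monoid.simps by blast
qed

lemma gwa_zero: "\<zero>\<^bsub>gwa R \<sigma> a\<^esub> = cls (Coef \<zero>)"
  and gwa_one: "\<one>\<^bsub>gwa R \<sigma> a\<^esub> = cls (Coef \<one>)"
  by (simp_all add: gwa_def)

lemmas cls_ring_eqs =
  gwa_cong.add_assoc[of _ R _ _ \<sigma> a, THEN cls_eqI]
  gwa_cong.add_zero[of _ R \<sigma> a, THEN cls_eqI] gwa_cong.add_neg[of _ R \<sigma> a, THEN cls_eqI]
  gwa_cong.mul_assoc[of _ R _ _ \<sigma> a, THEN cls_eqI]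
  gwa_cong.one_mul[of _ R \<sigma> a, THEN cls_eqI] gwa_cong.mul_one[of _ R \<sigma> a, THEN cls_eqI]
  gwa_cong.l_distr[of _ R _ _ \<sigma> a, THEN cls_eqI] gwa_cong.r_distr[of _ R _ _ \<sigma> a, THEN cls_eqI]

lemma gwa_ring: "ring (gwa R \<sigma> a)"
proof (rule ringI)
  show "abelian_group (gwa R \<sigma> a)"
  proof (rule abelian_groupI)
    show "x \<oplus>\<^bsub>gwa R \<sigma> a\<^esub> y = y \<oplus>\<^bsub>gwa R \<sigma> a\<^esub> x"
      if "x \<in> carrier (gwa R \<sigma> a)" "y \<in> carrier (gwa R \<sigma> a)" for x y
      using that unfolding gwa_carrier
      by (elim imageE) (simp add: gwa_add cls_eqI[OF gwa_cong.add_comm])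
    fix x assume "x \<in> carrier (gwa R \<sigma> a)"
    then obtain s where s: "s \<in> gwa_terms R" "x = cls s"
      by (auto simp: gwa_carrier)
    show "\<exists>y\<in>carrier (gwa R \<sigma> a). y \<oplus>\<^bsub>gwa R \<sigma> a\<^esub> x = \<zero>\<^bsub>gwa R \<sigma> a\<^esub>"
      by (rule bexI[of _ "cls (Neg s)"]) (use s in \<open>simp_all add: gwa_add gwa_zero cls_ring_eqs\<close>)
  qed (auto simp: gwa_carrier gwa_add gwa_zero cls_ring_eqs)
  show "monoid (gwa R \<sigma> a)"
    by (rule monoidI) (auto simp: gwa_carrier gwa_mult gwa_one cls_ring_eqs)
qed (auto simp: gwa_carrier gwa_add gwa_mult cls_ring_eqs)

lemma gwa_act_closed:
  "\<lbrakk>p \<in> carrier R; q \<in> carrier R; t \<in> gwa_terms R; r \<in> carrier R\<rbrakk>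
    \<Longrightarrow> gwa_act R \<sigma> p q t r \<in> carrier R"
  by (induction t arbitrary: r) auto

lemma gwa_act_add:
  "\<lbrakk>p \<in> carrier R; q \<in> carrier R; t \<in> gwa_terms R; r \<in> carrier R; s \<in> carrier R\<rbrakk>
    \<Longrightarrow> gwa_act R \<sigma> p q t (r \<oplus> s) = gwa_act R \<sigma> p q t r \<oplus> gwa_act R \<sigma> p q t s"
proof (induction t arbitrary: r s)
  case (Coef c)
  then show ?case by (simp add: r_distr)
next
  case (Add t u)
  have "gwa_act R \<sigma> p q v w \<in> carrier R" if "v \<in> {t, u}" "w \<in> {r, s}" for v w
    using that Add.prems gwa_act_closed by auto
  with Add show ?case
    by (simp add: a_ac)
next
  case (Neg t)
  then show ?case by (simp add: gwa_act_closed minus_add)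
qed (simp_all add: gwa_act_closed l_distr)

lemma gwa_act_cong:
  assumes p: "p \<in> carrier R" and c: "c \<in> carrier R" and a: "a = p \<otimes> c"
    and "gwa_cong R \<sigma> a s t" "r \<in> carrier R"
  shows "gwa_act R \<sigma> p (\<sigma> c) s r = gwa_act R \<sigma> p (\<sigma> c) t r"
  using assms(4,5)
proof (induction arbitrary: r rule: gwa_cong.induct)
  case (sym s t)
  then show ?case by metis
next
  case (trans s t u)
  then show ?case by metis
next
  case (mul s s' t t')
  have "gwa_act R \<sigma> p (\<sigma> c) t' r \<in> carrier R"
    using gwa_act_closed[OF p \<sigma>_closed[OF c]] gwa_cong_terms[OF mul.hyps(2)] mul.prems by blast
  then show ?case
    using mul.IH mul.prems by (metis gwa_act.simps(6))
next
  case (r_distr s t u)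
  then show ?case
    using p c by (simp add: gwa_act_closed gwa_act_add)
next
  case (add_neg s)
  then show ?case
    using p c by (simp add: gwa_act_closed l_neg)
next
  case (rel_X r')
  then show ?case
    using p by (simp add: m_ac)
next
  case (rel_Y r')
  then show ?case
    using c by (simp add: m_ac)
next
  case rel_XY
  then show ?case
    using p c by (simp add: a m_ac)
next
  case rel_YX
  then show ?case
    using p c by (simp add: a m_ac)
qed (use p c in \<open>simp_all add: gwa_act_closed a_ac m_assoc l_distr\<close>)

end

locale gwa_divisor = gwa_data R \<sigma> a + domain R
  for R :: "('a, 'm) ring_scheme" (structure) and \<sigma> a +
  fixes p :: 'a
  assumes p_closed [simp]: "p \<in> carrier R" and p_dvd: "p divides a" and a_nonzero: "a \<noteq> \<zero>"
begin

lemma p_nonzero: "p \<noteq> \<zero>"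
  using p_dvd a_nonzero by (auto elim!: dividesE)

lemma quo_closed [simp]: "quo R a p \<in> carrier R"
  and quo_mult: "a = p \<otimes> quo R a p"
proof -
  obtain c where c: "c \<in> carrier R" "a = p \<otimes> c"
    using p_dvd by (auto elim: dividesE)
  have "quo R a p = c"
    unfolding quo_def using c m_lcancel[OF p_nonzero p_closed] by (intro the_equality) auto
  then show "quo R a p \<in> carrier R" "a = p \<otimes> quo R a p"
    using c by simp_all
qed

lemma Vmod_simps [simp]:
  "carrier (Vmod R \<sigma> a p) = carrier R" "\<zero>\<^bsub>Vmod R \<sigma> a p\<^esub> = \<zero>" "add (Vmod R \<sigma> a p) = add R"
  by (simp_all add: Vmod_def)

lemma Vmod_smult:
  assumes "t \<in> gwa_terms R" "r \<in> carrier R"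
  shows "cls t \<odot>\<^bsub>Vmod R \<sigma> a p\<^esub> r = gwa_act R \<sigma> p (\<sigma> (quo R a p)) t r"
proof -
  have "gwa_cong R \<sigma> a t (SOME u. u \<in> cls t)"
    using someI[of "\<lambda>u. u \<in> cls t", OF cls_self[OF assms(1)]] by (simp add: mem_cls)
  from gwa_act_cong[OF p_closed quo_closed quo_mult this assms(2)] show ?thesis
    by (simp add: Vmod_def)
qed

lemma Vmod_abelian_group: "abelian_group (Vmod R \<sigma> a p)"
proof (rule abelian_groupI)
  show "\<exists>y\<in>carrier (Vmod R \<sigma> a p). y \<oplus>\<^bsub>Vmod R \<sigma> a p\<^esub> x = \<zero>\<^bsub>Vmod R \<sigma> a p\<^esub>"
    if "x \<in> carrier (Vmod R \<sigma> a p)" for x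
    using that l_neg[of x] by (intro bexI[of _ "\<ominus> x"]) simp_all
qed (simp_all add: a_ac)

lemma Vmod_left_module: "left_module (gwa R \<sigma> a) (Vmod R \<sigma> a p)"
  by (intro left_module.intro left_module_axioms.intro gwa_ring Vmod_abelian_group)
    (auto simp: gwa_carrier gwa_add gwa_mult gwa_one Vmod_smult gwa_act_closed gwa_act_add)

lemma Vmod_actions:
  assumes "r \<in> carrier R" "r' \<in> carrier R"
  shows "cls (Coef r') \<odot>\<^bsub>Vmod R \<sigma> a p\<^esub> r = r' \<otimes> r"
    and "cls GenX \<odot>\<^bsub>Vmod R \<sigma> a p\<^esub> r = inv_into (carrier R) \<sigma> r \<otimes> p"
    and "cls GenY \<odot>\<^bsub>Vmod R \<sigma> a p\<^esub> r = \<sigma> r \<otimes> \<sigma> (quo R a p)"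
  using assms by (simp_all add: Vmod_smult)

end

end

(*
  Every nonzero submodule of V_p is a nonzero ideal of the domain R, so any two of them meet and V_p has
  at most one simple submodule. A switch by p0 = sigma^n(q0) leads to a module that embeds into the
  previous one through multiplication by q0 sigma(q0) ... sigma^n(q0), and it decreases the number of
  pairs (z, w) of irreducible factors of q and p with z preceding w, counted with multiplicity. When no
  such pair is left the module is simple: a nonunit generator b of a submodule would have, on some orbit,
  a first and a last irreducible factor, and these would divide q and p.
*)

theory Submission
  imports Defs "HOL-Library.Multiset"
begin

section \<open>Left modules\<close>

text \<open>Uniqueness alone does not give existence: the simple submodule is read off an output of
  the procedure, so termination is part of the proof that the socle is nonzero. An output may depend
  on the choices made, but each one is carried onto a simple submodule, and there is only one of
  those. The multiplier solves an equation. Write \<tau> for the inverse of \<sigma>. Multiplication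
  by b maps V_p' linearly into V_p exactly if \<tau>(b) p = b p' and \<sigma>(b) q = b q'. For a
  switch at z = q0 the first condition prescribes \<tau>(b)/b = \<tau>(z)/\<sigma>^n(z), which the
  product of consecutive translates of z satisfies by telescoping. Infinite orbits enter twice: no
  irreducible reaches its own predecessor, so the count drops strictly, and the translates of an
  irreducible factor of b cannot all divide b in either direction. Multiplicities matter for the
  count although the stopping condition ignores them: with repeated factors the set of pairs of
  classes need not shrink in a switch.\<close>

lemma submodule_subset: "submodule N A M \<Longrightarrow> N \<subseteq> carrier M"
  using subgroup.subset[OF submodule.axioms(1)] by fastforce

lemma submodule_zero: "submodule N A M \<Longrightarrow> \<zero>\<^bsub>M\<^esub> \<in> N"
  using subgroup.one_closed[OF submodule.axioms(1)] by fastforce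

lemma submodule_add:
  "\<lbrakk>submodule N A M; x \<in> N; y \<in> N\<rbrakk> \<Longrightarrow> x \<oplus>\<^bsub>M\<^esub> y \<in> N"
  using subgroup.m_closed[OF submodule.axioms(1)] by fastforce

lemma (in left_module) zero_smult:
  assumes "x \<in> carrier M"
  shows "\<zero> \<odot>\<^bsub>M\<^esub> x = \<zero>\<^bsub>M\<^esub>"
proof -
  have "\<zero> \<odot>\<^bsub>M\<^esub> x \<oplus>\<^bsub>M\<^esub> \<zero> \<odot>\<^bsub>M\<^esub> x = \<zero> \<odot>\<^bsub>M\<^esub> x"
    using lm_l_distr[OF R.zero_closed R.zero_closed assms] by simp
  then show ?thesis
    using M.add.l_cancel_one[of "\<zero> \<odot>\<^bsub>M\<^esub> x" "\<zero> \<odot>\<^bsub>M\<^esub> x"] assms by simp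
qed

lemma (in left_module) minus_one_smult:
  assumes "x \<in> carrier M"
  shows "(\<ominus> \<one>) \<odot>\<^bsub>M\<^esub> x = \<ominus>\<^bsub>M\<^esub> x"
proof -
  have "(\<ominus> \<one>) \<odot>\<^bsub>M\<^esub> x \<oplus>\<^bsub>M\<^esub> x = \<zero>\<^bsub>M\<^esub>"
    using lm_l_distr[of "\<ominus> \<one>" \<one> x] assms by (simp add: R.l_neg zero_smult)
  then show ?thesis
    using M.minus_equality[of "(\<ominus> \<one>) \<odot>\<^bsub>M\<^esub> x" x] assms by simp
qed

text \<open>Additive inverses are the multiples by \<open>\<ominus> \<one>\<close>, so closure under
  scalars already covers them.\<close>

lemma (in left_module) submoduleI:
  assumes "N \<subseteq> carrier M" "\<zero>\<^bsub>M\<^esub> \<in> N"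
    and "\<And>x y. \<lbrakk>x \<in> N; y \<in> N\<rbrakk> \<Longrightarrow> x \<oplus>\<^bsub>M\<^esub> y \<in> N"
    and smult: "\<And>r x. \<lbrakk>r \<in> carrier R; x \<in> N\<rbrakk> \<Longrightarrow> r \<odot>\<^bsub>M\<^esub> x \<in> N"
  shows "submodule N R M"
proof (intro submodule.intro subgroup.intro submodule_axioms.intro)
  fix x assume x: "x \<in> N"
  then have "\<ominus>\<^bsub>M\<^esub> x \<in> N"
    using minus_one_smult[of x] smult[of "\<ominus> \<one>" x] assms(1) by auto
  then show "inv\<^bsub>add_monoid M\<^esub> x \<in> N"
    by (simp add: a_inv_def)
qed (use assms in auto)

lemma (in left_module) left_module_submodule:
  assumes "submodule N R M"
  shows "left_module R (M\<lparr>carrier := N\<rparr>)"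
proof -
  have sub: "x \<in> carrier M" if "x \<in> N" for x
    using submodule_subset[OF assms] that by blast
  have "abelian_group (M\<lparr>carrier := N\<rparr>)"
  proof (rule abelian_groupI)
    fix x assume x: "x \<in> carrier (M\<lparr>carrier := N\<rparr>)"
    then have "\<ominus>\<^bsub>M\<^esub> x \<in> N"
      using minus_one_smult[of x] submodule.smult_closed[OF assms, of "\<ominus> \<one>" x] sub by simp
    then show "\<exists>y\<in>carrier (M\<lparr>carrier := N\<rparr>). y \<oplus>\<^bsub>M\<lparr>carrier := N\<rparr>\<^esub> x = \<zero>\<^bsub>M\<lparr>carrier := N\<rparr>\<^esub>"
      using x sub by (intro bexI[of _ "\<ominus>\<^bsub>M\<^esub> x"]) (simp_all add: M.l_neg)
  qed (simp_all add: submodule_add[OF assms] submodule_zero[OF assms] sub M.a_ac)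
  then show ?thesis
    by (intro left_module.intro left_module_axioms.intro R.ring_axioms)
      (simp_all add: submodule.smult_closed[OF assms] sub lm_l_distr lm_r_distr lm_assoc)
qed

lemma simple_moduleD:
  assumes "simple_module A M"
  shows "left_module A M" "carrier M \<noteq> {\<zero>\<^bsub>M\<^esub>}"
    "submodule N A M \<Longrightarrow> N = {\<zero>\<^bsub>M\<^esub>} \<or> N = carrier M"
  using assms unfolding simple_module_def by auto

lemma (in left_module) submodule_Int:
  assumes "submodule N R M" "submodule N' R M"
  shows "submodule (N \<inter> N') R M"
  by (rule submoduleI)
    (use assms[THEN submodule_subset] assms[THEN submodule_zero] submodule_add[OF assms(1)]
       submodule_add[OF assms(2)] submodule.smult_closed[OF assms(1)]
       submodule.smult_closed[OF assms(2)] in auto)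

lemma (in left_module) submodule_of_submodule:
  assumes "submodule S R M" "submodule N R M" "N \<subseteq> S"
  shows "submodule N R (M\<lparr>carrier := S\<rparr>)"
proof -
  interpret S: left_module R "M\<lparr>carrier := S\<rparr>"
    by (rule left_module_submodule[OF assms(1)])
  show ?thesis
    by (rule S.submoduleI)
      (use assms submodule_zero[OF assms(2)] submodule_add[OF assms(2)]
         submodule.smult_closed[OF assms(2)] in auto)
qed

text \<open>The intersection is a submodule of the simple module on \<open>S\<close>; being nonzero,
  it is all of \<open>S\<close>.\<close>

lemma simple_submodule_Int:
  assumes "left_module A M" "simple_submodule A M S" "submodule N A M" "S \<inter> N \<noteq> {\<zero>\<^bsub>M\<^esub>}"
  shows "S \<subseteq> N"
proof -
  interpret left_module A M by fact
  have S: "submodule S A M" "simple_module A (M\<lparr>carrier := S\<rparr>)"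
    using assms(2) unfolding simple_submodule_def by auto
  have "submodule (S \<inter> N) A (M\<lparr>carrier := S\<rparr>)"
    using submodule_of_submodule[OF S(1) submodule_Int[OF S(1) assms(3)]] by blast
  from simple_moduleD(3)[OF S(2) this] assms(4) show ?thesis by auto
qed

lemma socle_unique_simple:
  assumes "simple_submodule A M S" "\<And>T. simple_submodule A M T \<Longrightarrow> T = S"
  shows "socle A M = S"
proof
  have "submodule S A M"
    using assms(1) unfolding simple_submodule_def by blast
  then show "socle A M \<subseteq> S"
    unfolding socle_def using assms(2) by auto
  show "S \<subseteq> socle A M"
    unfolding socle_def using assms(1) by auto
qed

section \<open>Injective homomorphisms and the images of simple modules\<close>

context
  fixes A :: "('a, 'm) ring_scheme" and M :: "('a, 'b) module" and M' :: "('a, 'c) module" and f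
  assumes M: "left_module A M" and M': "left_module A M'"
    and f_closed: "\<And>x. x \<in> carrier M' \<Longrightarrow> f x \<in> carrier M"
    and f_inj: "inj_on f (carrier M')"
    and f_add: "\<And>x y. \<lbrakk>x \<in> carrier M'; y \<in> carrier M'\<rbrakk> \<Longrightarrow> f (x \<oplus>\<^bsub>M'\<^esub> y) = f x \<oplus>\<^bsub>M\<^esub> f y"
    and f_smult: "\<And>r x. \<lbrakk>r \<in> carrier A; x \<in> carrier M'\<rbrakk> \<Longrightarrow> f (r \<odot>\<^bsub>M'\<^esub> x) = r \<odot>\<^bsub>M\<^esub> f x"
begin

interpretation M: left_module A M by (rule M)
interpretation M': left_module A M' by (rule M')

lemma hom_zero: "f \<zero>\<^bsub>M'\<^esub> = \<zero>\<^bsub>M\<^esub>"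
  using f_smult[of "\<zero>\<^bsub>A\<^esub>" "\<zero>\<^bsub>M'\<^esub>"] by (simp add: M'.zero_smult M.zero_smult f_closed)

lemma submodule_hom_image: "submodule (f ` carrier M') A M"
proof (rule M.submoduleI)
  show "\<zero>\<^bsub>M\<^esub> \<in> f ` carrier M'"
    using imageI[OF M'.M.zero_closed, of f] hom_zero by simp
qed (auto simp: f_closed f_add[symmetric] f_smult[symmetric])

text \<open>A submodule of the image is the image of its preimage, and the preimage is a submodule
  of the simple module \<open>M'\<close>.\<close>

lemma simple_submodule_hom_image:
  assumes "simple_module A M'"
  shows "simple_submodule A M (f ` carrier M')"
proof -
  let ?I = "M\<lparr>carrier := f ` carrier M'\<rparr>"
  have "N = {\<zero>\<^bsub>M\<^esub>} \<or> N = f ` carrier M'" if N: "submodule N A ?I" for N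
  proof -
    let ?N = "{x \<in> carrier M'. f x \<in> N}"
    have N_eq: "N = f ` ?N"
      using submodule_subset[OF N] by auto
    have "submodule ?N A M'"
      by (rule M'.submoduleI)
        (use submodule_zero[OF N] submodule_add[OF N] submodule.smult_closed[OF N]
          in \<open>auto simp: hom_zero f_add f_smult\<close>)
    then consider "?N = {\<zero>\<^bsub>M'\<^esub>}" | "?N = carrier M'"
      using simple_moduleD(3)[OF assms] by blast
    then show ?thesis
      using N_eq hom_zero by cases auto
  qed
  moreover have "f ` carrier M' \<noteq> {\<zero>\<^bsub>M\<^esub>}"
  proof
    assume *: "f ` carrier M' = {\<zero>\<^bsub>M\<^esub>}"
    have "x = \<zero>\<^bsub>M'\<^esub>" if "x \<in> carrier M'" for x
      using * that hom_zero inj_onD[OF f_inj, of x "\<zero>\<^bsub>M'\<^esub>"] by auto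
    then show False
      using simple_moduleD(2)[OF assms] M'.M.zero_closed by blast
  qed
  ultimately show ?thesis
    unfolding simple_submodule_def simple_module_def
    using submodule_hom_image M.left_module_submodule[OF submodule_hom_image] by simp
qed

lemma hom_image_isomorphic: "module_isomorphic A (M\<lparr>carrier := f ` carrier M'\<rparr>) M'"
proof -
  have "inv_into (carrier M') f \<in> module_iso A (M\<lparr>carrier := f ` carrier M'\<rparr>) M'"
    unfolding module_iso_def
    using bij_betw_inv_into[OF inj_on_imp_bij_betw[OF f_inj]]
    by (auto simp: f_inj f_add[symmetric] f_smult[symmetric])
  then show ?thesis
    unfolding module_isomorphic_def by blast
qed

end


section \<open>Factorizations in principal ideal domains\<close>

text \<open>Factorization up to a unit. Putting the unit into the base case keeps the relation
  stable under unit multiples, which is what cancelling a factor up to associates requires.\<close>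

inductive irr_factors :: "('a, 'm) ring_scheme \<Rightarrow> 'a multiset \<Rightarrow> 'a \<Rightarrow> bool" for R where
  unit: "u \<in> Units R \<Longrightarrow> irr_factors R {#} u"
| mult: "\<lbrakk>c \<in> carrier R; ring_irreducible\<^bsub>R\<^esub> c; irr_factors R P r\<rbrakk> \<Longrightarrow>
    irr_factors R (add_mset c P) (c \<otimes>\<^bsub>R\<^esub> r)"

context principal_domain
begin

lemma irr_factors_closed: "irr_factors R P r \<Longrightarrow> r \<in> carrier R \<and> set_mset P \<subseteq> carrier R"
  by (induction rule: irr_factors.induct) auto

lemma irr_factors_exist:
  assumes "r \<in> carrier R" "r \<noteq> \<zero>"
  shows "\<exists>P. irr_factors R P r"
proof (cases "r \<in> Units R")
  case True
  then show ?thesis by (blast intro: irr_factors.unit)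
next
  case False
  then obtain fs where fs: "set fs \<subseteq> carrier R - {\<zero>}" "\<forall>f\<in>set fs. irreducible (mult_of R) f"
      "foldr (\<otimes>) fs \<one> = r"
    using mult_of.factors_exist[of r] assms by (auto simp: factors_def)
  from fs(1,2) have "irr_factors R (mset fs) (foldr (\<otimes>) fs \<one>)"
    by (induction fs) (auto intro!: irr_factors.intros ring_irreducibleI')
  with fs(3) show ?thesis by auto
qed

lemma irr_factors_unit_mult:
  assumes "irr_factors R P r" "u \<in> Units R"
  shows "irr_factors R P (u \<otimes> r)"
  using assms
proof (induction rule: irr_factors.induct)
  case (mult c P r)
  have "u \<otimes> (c \<otimes> r) = c \<otimes> (u \<otimes> r)"
    using mult irr_factors_closed[OF mult.hyps(3)] by (simp add: m_lcomm Units_closed)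
  then show ?case
    using mult by (auto intro: irr_factors.mult)
qed (auto intro: irr_factors.unit)

lemma irreducible_dvd_mult:
  assumes "z \<in> carrier R" "ring_irreducible z" "r \<in> carrier R" "s \<in> carrier R" "z divides r \<otimes> s"
  shows "z divides r \<or> z divides s"
  using assms primeness_condition ring_primeE(3) unfolding prime_def by blast

lemma irreducible_dvd_irreducible:
  assumes "z \<in> carrier R" "ring_irreducible z" "c \<in> carrier R" "ring_irreducible c" "z divides c"
  obtains u where "u \<in> Units R" "c = z \<otimes> u"
proof -
  obtain u where u: "u \<in> carrier R" "c = z \<otimes> u"
    using assms(5) by (auto elim: dividesE)
  then have "u \<in> Units R"
    using ring_irreducibleE(5)[OF assms(3,4) assms(1) u(1)] ring_irreducibleE(4)[OF assms(1,2)] by blast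
  with u that show ?thesis by blast
qed

text \<open>Irreducibles are prime here, so \<open>z\<close> divides the head \<open>c\<close> or
  the remaining product. In the first case \<open>z\<close> and \<open>c\<close> differ by a unit,
  which moves into the cofactor; in the second the induction applies. This is uniqueness of
  factorization in the form needed for counting factors.\<close>

lemma irr_factors_remove:
  assumes "irr_factors R P r" "z \<in> carrier R" "ring_irreducible z" "s \<in> carrier R" "r = z \<otimes> s"
  shows "\<exists>c P'. P = add_mset c P' \<and> z \<sim> c \<and> irr_factors R P' s"
  using assms
proof (induction arbitrary: s rule: irr_factors.induct)
  case (unit u)
  then have "z \<in> Units R"
    using unit_factor by blast
  then show ?case
    using ring_irreducibleE(4) unit by blast
next
  case (mult c P r)
  have r: "r \<in> carrier R"
    using irr_factors_closed mult.hyps(3) by blast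
  have z0: "z \<noteq> \<zero>"
    using ring_irreducibleE(1) mult.prems by blast
  have "z divides c \<otimes> r"
    using mult.prems by (auto intro: dividesI)
  then consider "z divides c" | "z divides r"
    using irreducible_dvd_mult mult.prems mult.hyps r by blast
  then show ?case
  proof cases
    case 1
    then obtain u where u: "u \<in> Units R" "c = z \<otimes> u"
      using irreducible_dvd_irreducible mult.prems mult.hyps by blast
    have "z \<otimes> s = z \<otimes> (u \<otimes> r)"
      using mult.prems(4) u r mult.prems(1) by (simp add: m_assoc Units_closed)
    then have "s = u \<otimes> r"
      using m_lcancel[OF z0 mult.prems(1)] u r mult.prems(3) by auto
    moreover have "z \<sim> c"
      using associated_sym[OF associatedI2'[OF u(2,1) mult.prems(1)]] .
    ultimately show ?thesis
      using irr_factors_unit_mult[OF mult.hyps(3) u(1)] by blast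
  next
    case 2
    then obtain s' where s': "s' \<in> carrier R" "r = z \<otimes> s'"
      by (auto elim: dividesE)
    have "z \<otimes> s = z \<otimes> (c \<otimes> s')"
      using mult.prems s' mult.hyps(1) by (simp add: m_lcomm)
    then have s: "s = c \<otimes> s'"
      using m_lcancel[OF z0 mult.prems(1)] s' mult.hyps(1) mult.prems(3) by auto
    obtain c' P' where "P = add_mset c' P'" "z \<sim> c'" "irr_factors R P' s'"
      using mult.IH[OF mult.prems(1,2) s'] by blast
    then have "add_mset c P = add_mset c' (add_mset c P') \<and> z \<sim> c' \<and> irr_factors R (add_mset c P') s"
      using s mult.hyps by (auto intro: irr_factors.mult)
    then show ?thesis by blast
  qed
qed

text \<open>Each \<open>f n\<close> is associated with a member of one fixed finite multiset of
  factors of \<open>b\<close>; this assignment is injective because the \<open>f n\<close> are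
  pairwise not associated.\<close>

lemma not_all_divide:
  fixes f :: "nat \<Rightarrow> 'a"
  assumes f: "\<And>n. f n \<in> carrier R" "\<And>n. ring_irreducible (f n)"
    and "\<And>m n. m < n \<Longrightarrow> \<not> f m \<sim> f n" and b: "b \<in> carrier R" "b \<noteq> \<zero>"
  shows "\<exists>n. \<not> f n divides b"
proof (rule ccontr)
  assume "\<not> ?thesis"
  then have dvd: "f n divides b" for n by blast
  obtain P where P: "irr_factors R P b"
    using irr_factors_exist b by blast
  have "\<exists>c. c \<in># P \<and> f n \<sim> c" for n
  proof -
    obtain s where "s \<in> carrier R" "b = f n \<otimes> s"
      using dvd[of n] by (auto elim: dividesE)
    from irr_factors_remove[OF P f this] show ?thesis by auto
  qed
  then obtain g where g: "\<And>n. g n \<in># P" "\<And>n. f n \<sim> g n" by metis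
  have "inj g"
  proof (rule linorder_injI)
    fix m n :: nat assume "m < n"
    moreover have "f m \<sim> f n" if "g m = g n"
      using g(2)[of m] g(2)[of n] that f(1) irr_factors_closed[OF P] g(1)
      by (metis associated_sym associated_trans subsetD)
    ultimately show "g m \<noteq> g n" using assms(3) by blast
  qed
  moreover have "range g \<subseteq> set_mset P" using g(1) by blast
  ultimately show False
    using finite_subset[of "range g" "set_mset P"] range_inj_infinite[of g] by auto
qed

end


section \<open>The automorphism and its orbits\<close>

context gwa_data
begin

lemma \<sigma>n_closed [simp]: "r \<in> carrier R \<Longrightarrow> (\<sigma> ^^ n) r \<in> carrier R"
  by (induction n) auto

lemma \<tau>n_closed [simp]: "r \<in> carrier R \<Longrightarrow> (\<tau> ^^ n) r \<in> carrier R"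
  by (induction n) auto

lemma \<sigma>n_\<tau>n [simp]: "r \<in> carrier R \<Longrightarrow> (\<sigma> ^^ n) ((\<tau> ^^ n) r) = r"
  by (induction n arbitrary: r) (simp_all add: funpow_swap1[of \<sigma>])

lemma \<sigma>_one [simp]: "\<sigma> \<one> = \<one>"
  using ring_iso_memE(4)[OF \<sigma>_iso] .

lemma \<sigma>_zero_iff [simp]: "r \<in> carrier R \<Longrightarrow> \<sigma> r = \<zero> \<longleftrightarrow> r = \<zero>"
  using \<sigma>_add[of \<zero> \<zero>] \<sigma>_inj[of r \<zero>] add.l_cancel_one[of "\<sigma> \<zero>" "\<sigma> \<zero>"] by auto

lemma \<sigma>_divides: "\<lbrakk>r divides s; r \<in> carrier R\<rbrakk> \<Longrightarrow> \<sigma> r divides \<sigma> s"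
  by (auto simp: factor_def)

lemma \<tau>_divides: "\<lbrakk>r divides s; r \<in> carrier R\<rbrakk> \<Longrightarrow> \<tau> r divides \<tau> s"
  by (auto simp: factor_def)

lemma \<sigma>_divides_iff: "\<lbrakk>r \<in> carrier R; s \<in> carrier R\<rbrakk> \<Longrightarrow> \<sigma> r divides \<sigma> s \<longleftrightarrow> r divides s"
  using \<sigma>_divides[of r s] \<tau>_divides[of "\<sigma> r" "\<sigma> s"] by auto

lemma \<sigma>n_divides_iff:
  "\<lbrakk>r \<in> carrier R; s \<in> carrier R\<rbrakk> \<Longrightarrow> (\<sigma> ^^ n) r divides (\<sigma> ^^ n) s \<longleftrightarrow> r divides s"
  by (induction n) (simp_all add: \<sigma>_divides_iff)

lemma \<sigma>n_assoc_iff: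
  "\<lbrakk>r \<in> carrier R; s \<in> carrier R\<rbrakk> \<Longrightarrow> (\<sigma> ^^ n) r \<sim> (\<sigma> ^^ n) s \<longleftrightarrow> r \<sim> s"
  by (simp add: associated_def \<sigma>n_divides_iff)

lemma \<sigma>_unit_iff: "r \<in> carrier R \<Longrightarrow> \<sigma> r \<in> Units R \<longleftrightarrow> r \<in> Units R"
  using \<sigma>_divides_iff[of r \<one>] by (simp add: divides_one)

lemma assocs_eq_iff:
  assumes "r \<in> carrier R" "s \<in> carrier R"
  shows "assocs R r = assocs R s \<longleftrightarrow> r \<sim> s"
proof
  assume "r \<sim> s"
  then have "s \<in> assocs R r"
    using assms by (auto simp: eq_closure_of_def elem_def intro: associated_sym)
  then show "assocs R r = assocs R s"
    using assocs_repr_independence assms by blast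
qed (use assms assocs_eqD associated_sym in blast)

text \<open>Orbits are formed from images of classes as sets. This turns such an image back into the
  class of a translated element.\<close>

lemma \<sigma>_assocs: "r \<in> carrier R \<Longrightarrow> \<sigma> ` assocs R r = assocs R (\<sigma> r)"
proof -
  assume r: "r \<in> carrier R"
  have mem: "x \<in> assocs R y \<longleftrightarrow> x \<in> carrier R \<and> x \<sim> y" for x y
    by (auto simp: eq_closure_of_def elem_def)
  have "x \<in> \<sigma> ` assocs R r" if "x \<in> assocs R (\<sigma> r)" for x
    using that r mem \<sigma>n_assoc_iff[of "\<tau> x" r 1] by (intro image_eqI[of _ _ "\<tau> x"]) auto
  moreover have "\<sigma> x \<in> assocs R (\<sigma> r)" if "x \<in> assocs R r" for x
    using that r mem \<sigma>n_assoc_iff[of x r 1] by auto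
  ultimately show ?thesis by blast
qed

lemma \<tau>_assocs: "r \<in> carrier R \<Longrightarrow> \<tau> ` assocs R (\<sigma> r) = assocs R r"
proof -
  assume r: "r \<in> carrier R"
  have "assocs R r \<subseteq> carrier R"
    by (auto simp: eq_closure_of_def elem_def)
  then have "\<tau> ` \<sigma> ` assocs R r = assocs R r"
    using \<sigma>_bij by (simp add: bij_betw_def)
  with r show ?thesis by (simp add: \<sigma>_assocs)
qed

text \<open>The classes of the translates with exponents \<open>0\<close> to \<open>k\<close> form a
  cycle, since exponent \<open>Suc k\<close> gives the first class again. The cycle is closed under
  both \<sigma> and \<tau>, hence contains the whole orbit.\<close>

lemma finite_aut_orbit:
  assumes r: "r \<in> carrier R" and assoc: "(\<sigma> ^^ Suc k) r \<sim> r"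
  shows "finite (aut_orbit R \<sigma> (assocs R r))"
proof -
  let ?F = "(\<lambda>j. assocs R ((\<sigma> ^^ j) r)) ` {..k}"
  have eq: "assocs R ((\<sigma> ^^ Suc k) r) = assocs R r"
    using assoc r assocs_eq_iff by (simp del: funpow.simps)
  have "\<sigma> ` Z \<in> ?F" if Z: "Z \<in> ?F" for Z
  proof -
    obtain j where j: "j \<le> k" "Z = assocs R ((\<sigma> ^^ j) r)" using Z by auto
    then have "\<sigma> ` Z = assocs R ((\<sigma> ^^ Suc j) r)"
      using r by (simp add: \<sigma>_assocs)
    then show ?thesis
    proof (cases "j = k")
      case True
      \<comment> \<open>The cycle closes here: exponent \<open>Suc k\<close> is replaced by exponent
        \<open>0\<close>.\<close>
      then show ?thesis using \<open>\<sigma> ` Z = _\<close> eq by (intro image_eqI[of _ _ 0]) simp_all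
    qed (use \<open>j \<le> k\<close> in \<open>intro image_eqI[of _ _ "Suc j"], auto\<close>)
  qed
  then have \<sigma>n: "(\<sigma> ^^ n) ` assocs R r \<in> ?F" for n
  proof (induction n)
    case 0
    show ?case by (intro image_eqI[of _ _ 0]) auto
  next
    case (Suc n)
    then show ?case by (simp only: funpow.simps image_comp[symmetric])
  qed
  have "\<tau> ` Z \<in> ?F" if Z: "Z \<in> ?F" for Z
  proof -
    obtain j where j: "j \<le> k" "Z = assocs R ((\<sigma> ^^ j) r)" using Z by auto
    show ?thesis
    proof (cases j)
      case 0
      \<comment> \<open>To step back from exponent \<open>0\<close>, the class is first rewritten
        with exponent \<open>Suc k\<close>.\<close>
      then have "Z = assocs R (\<sigma> ((\<sigma> ^^ k) r))"
        using j eq by simp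
      then have "\<tau> ` Z = assocs R ((\<sigma> ^^ k) r)"
        using r \<tau>_assocs[of "(\<sigma> ^^ k) r"] by simp
      then show ?thesis by auto
    next
      case (Suc i)
      then have "\<tau> ` Z = assocs R ((\<sigma> ^^ i) r)"
        using j r \<tau>_assocs[of "(\<sigma> ^^ i) r"] by simp
      then show ?thesis using Suc j by auto
    qed
  qed
  then have \<tau>n: "(\<tau> ^^ n) ` assocs R r \<in> ?F" for n
  proof (induction n)
    case 0
    show ?case by (intro image_eqI[of _ _ 0]) auto
  next
    case (Suc n)
    then show ?case by (simp only: funpow.simps image_comp[symmetric])
  qed
  have "aut_orbit R \<sigma> (assocs R r) \<subseteq> ?F"
    using \<sigma>n \<tau>n by (auto simp: aut_orbit_def aut_pow_def simp del: image_iff)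
  then show ?thesis
    using finite_subset by blast
qed

end

locale gwa_pid = gwa_data R \<sigma> a + principal_domain R
  for R :: "('a, 'm) ring_scheme" (structure) and \<sigma> a +
  assumes a_nonzero: "a \<noteq> \<zero>"
    and infinite_orbits: "\<And>z. z \<in> Irr R \<Longrightarrow> infinite (aut_orbit R \<sigma> z)"
begin

lemma \<sigma>_irreducible:
  assumes z: "z \<in> carrier R" and irr: "ring_irreducible z"
  shows "ring_irreducible (\<sigma> z)"
proof (rule ring_irreducibleI)
  show "\<sigma> z \<in> carrier R - {\<zero>}" "\<sigma> z \<notin> Units R"
    using z ring_irreducibleE(1,4)[OF z irr] by (auto simp: \<sigma>_unit_iff)
  fix r s assume rs: "r \<in> carrier R" "s \<in> carrier R" "\<sigma> z = r \<otimes> s"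
  then have "z = \<tau> r \<otimes> \<tau> s"
    using z by (metis \<tau>_\<sigma> \<tau>_mult)
  then have "\<tau> r \<in> Units R \<or> \<tau> s \<in> Units R"
    using ring_irreducibleE(5)[OF z irr, of "\<tau> r" "\<tau> s"] rs by simp
  then show "r \<in> Units R \<or> s \<in> Units R"
    using \<sigma>_unit_iff[of "\<tau> r"] \<sigma>_unit_iff[of "\<tau> s"] rs by simp
qed

lemma \<tau>_irreducible:
  assumes z: "z \<in> carrier R" and irr: "ring_irreducible z"
  shows "ring_irreducible (\<tau> z)"
proof (rule ring_irreducibleI)
  have "\<tau> z \<noteq> \<zero>"
    using ring_irreducibleE(1)[OF z irr] \<sigma>_\<tau>[OF z] \<sigma>_zero_iff[of \<zero>] by auto
  then show "\<tau> z \<in> carrier R - {\<zero>}" "\<tau> z \<notin> Units R"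
    using z ring_irreducibleE(4)[OF z irr] \<sigma>_unit_iff[of "\<tau> z"] by auto
  fix r s assume rs: "r \<in> carrier R" "s \<in> carrier R" "\<tau> z = r \<otimes> s"
  then have "z = \<sigma> r \<otimes> \<sigma> s"
    using z by (metis \<sigma>_\<tau> \<sigma>_mult)
  then show "r \<in> Units R \<or> s \<in> Units R"
    using ring_irreducibleE(5)[OF z irr, of "\<sigma> r" "\<sigma> s"] rs by (simp add: \<sigma>_unit_iff)
qed

lemma \<sigma>n_irreducible:
  "\<lbrakk>z \<in> carrier R; ring_irreducible z\<rbrakk> \<Longrightarrow> ring_irreducible ((\<sigma> ^^ n) z)"
  by (induction n) (simp_all add: \<sigma>_irreducible)

lemma \<tau>n_irreducible:
  "\<lbrakk>z \<in> carrier R; ring_irreducible z\<rbrakk> \<Longrightarrow> ring_irreducible ((\<tau> ^^ n) z)"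
  by (induction n) (simp_all add: \<tau>_irreducible)

lemma not_assoc_\<sigma>n:
  assumes "z \<in> carrier R" "ring_irreducible z" "0 < n"
  shows "\<not> (\<sigma> ^^ n) z \<sim> z"
proof
  assume "(\<sigma> ^^ n) z \<sim> z"
  moreover obtain k where "n = Suc k" using assms(3) gr0_implies_Suc by blast
  moreover have "assocs R z \<in> Irr R" using assms by (auto simp: Irr_def)
  ultimately show False
    using finite_aut_orbit[of z k] infinite_orbits assms(1) by blast
qed

lemma not_all_\<sigma>n_divide:
  assumes z: "z \<in> carrier R" "ring_irreducible z" and b: "b \<in> carrier R" "b \<noteq> \<zero>"
  shows "\<exists>n. \<not> (\<sigma> ^^ n) z divides b"
proof (rule not_all_divide[OF _ _ _ b])
  fix m n :: nat assume "m < n"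
  then have "n = m + (n - m)" by simp
  then have "(\<sigma> ^^ n) z = (\<sigma> ^^ m) ((\<sigma> ^^ (n - m)) z)"
    by (metis funpow_add comp_apply)
  then show "\<not> (\<sigma> ^^ m) z \<sim> (\<sigma> ^^ n) z"
    using z not_assoc_\<sigma>n[OF z, of "n - m"] \<open>m < n\<close> \<sigma>n_assoc_iff[of z "(\<sigma> ^^ (n - m)) z" m]
      associated_sym by auto
qed (use z \<sigma>n_irreducible in simp_all)

lemma not_all_\<tau>n_divide:
  assumes z: "z \<in> carrier R" "ring_irreducible z" and b: "b \<in> carrier R" "b \<noteq> \<zero>"
  shows "\<exists>n. \<not> (\<tau> ^^ n) z divides b"
proof (rule not_all_divide[OF _ _ _ b])
  fix m n :: nat assume "m < n"
  then have "n = (n - m) + m" by simp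
  \<comment> \<open>Applying \<open>\<sigma> ^^ n\<close> to both backward translates yields
    \<open>(\<sigma> ^^ (n - m)) z\<close> and \<open>z\<close>, which are not associated.\<close>
  then have "(\<sigma> ^^ n) ((\<tau> ^^ m) z) = (\<sigma> ^^ (n - m)) ((\<sigma> ^^ m) ((\<tau> ^^ m) z))"
    by (metis funpow_add comp_apply)
  then show "\<not> (\<tau> ^^ m) z \<sim> (\<tau> ^^ n) z"
    using z not_assoc_\<sigma>n[OF z, of "n - m"] \<open>m < n\<close>
      \<sigma>n_assoc_iff[of "(\<tau> ^^ m) z" "(\<tau> ^^ n) z" n] by auto
qed (use z \<tau>n_irreducible in simp_all)

end


section \<open>The switching procedure\<close>

context gwa_pid
begin

lemma quo_eq:
  assumes "s \<in> carrier R" "s \<noteq> \<zero>" "c \<in> carrier R"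
  shows "quo R (s \<otimes> c) s = c"
  unfolding quo_def using assms m_lcancel[OF assms(2,1)] by (intro the_equality) auto

lemma dividesD_Irr_of:
  assumes "r \<in> carrier R" "assocs R r \<in> Irr_of R s"
  shows "r divides s"
proof -
  obtain c where "c \<in> carrier R" "c divides s" "assocs R r = assocs R c"
    using assms(2) by (auto simp: Irr_of_def)
  then show ?thesis
    using assms(1) assocs_eq_iff associated_def divides_trans by metis
qed

lemma Irr_ofI: "\<lbrakk>r \<in> carrier R; ring_irreducible r; r divides s\<rbrakk> \<Longrightarrow> assocs R r \<in> Irr_of R s"
  by (auto simp: Irr_of_def)

text \<open>Divisibility does not distinguish associates, so the factor of \<open>p\<close> can be
  taken to be an exact translate of the factor of \<open>q\<close>. A switch asks for its two
  factors in this form.\<close>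

lemma Omega_nonempty_iff:
  "Omega R \<sigma> (p, q) \<noteq> {} \<longleftrightarrow>
    (\<exists>z\<in>carrier R. \<exists>n. ring_irreducible z \<and> z divides q \<and> (\<sigma> ^^ n) z divides p)"
proof
  assume "Omega R \<sigma> (p, q) \<noteq> {}"
  then obtain c d where cd: "c \<in> carrier R" "ring_irreducible c" "c divides q"
      "d \<in> carrier R" "d divides p" and "prec R \<sigma> (assocs R c) (assocs R d)"
    by (auto simp: Omega_def Irr_of_def)
  then obtain r s n where rs: "r \<in> carrier R" "s \<in> carrier R" "assocs R c = assocs R r"
      "assocs R d = assocs R s" "assocs R ((\<sigma> ^^ n) r) = assocs R s"
    by (auto simp: prec_def)
  then have "c \<sim> r" "(\<sigma> ^^ n) r \<sim> d"
    using cd assocs_eq_iff[of "(\<sigma> ^^ n) r" d] by (simp_all flip: assocs_eq_iff)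
  then have "(\<sigma> ^^ n) c divides p"
    using rs(1) cd \<sigma>n_assoc_iff[of c r n] by (meson associated_def divides_trans \<sigma>n_closed)
  then show "\<exists>z\<in>carrier R. \<exists>n. ring_irreducible z \<and> z divides q \<and> (\<sigma> ^^ n) z divides p"
    using cd by blast
next
  assume "\<exists>z\<in>carrier R. \<exists>n. ring_irreducible z \<and> z divides q \<and> (\<sigma> ^^ n) z divides p"
  then obtain z n where z: "z \<in> carrier R" "ring_irreducible z" "z divides q"
      "(\<sigma> ^^ n) z divides p" by blast
  then have "(assocs R z, assocs R ((\<sigma> ^^ n) z)) \<in> Omega R \<sigma> (p, q)"
    using \<sigma>n_closed[OF z(1), of n] Irr_ofI \<sigma>n_irreducible
    unfolding Omega_def prec_def by blast
  then show "Omega R \<sigma> (p, q) \<noteq> {}" by blast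
qed

text \<open>A pair at minimal distance \<open>n\<close> among all linked pairs is admissible: a pair
  violating the side condition would be linked at a smaller distance.\<close>

lemma switch_step_exists:
  assumes "Omega R \<sigma> (p, q) \<noteq> {}"
  shows "\<exists>st. switch_step R \<sigma> (p, q) st"
proof -
  define linked where
    "linked z n \<longleftrightarrow> z \<in> carrier R \<and> ring_irreducible z \<and> z divides q \<and> (\<sigma> ^^ n) z divides p" for z n
  define n where "n = (LEAST n. \<exists>z. linked z n)"
  have ex: "\<exists>n z. linked z n"
    using assms unfolding Omega_nonempty_iff linked_def by blast
  obtain z where z: "linked z n"
    using LeastI_ex[OF ex] unfolding n_def by blast
  have least: "n \<le> m" if "linked y m" for y m
    unfolding n_def using that by (auto intro: Least_le)
  have "n \<le> j - i" if ij: "i \<le> j" "assocs R ((\<sigma> ^^ i) z) \<in> Irr_of R q"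
      "assocs R ((\<sigma> ^^ j) z) \<in> Irr_of R p" for i j
  proof (rule least[of "(\<sigma> ^^ i) z"])
    have "(\<sigma> ^^ j) z = (\<sigma> ^^ (j - i)) ((\<sigma> ^^ i) z)"
      using ij(1) by (metis funpow_add comp_apply le_add_diff_inverse2)
    then show "linked ((\<sigma> ^^ i) z) (j - i)"
      using z ij(2,3) dividesD_Irr_of[of "(\<sigma> ^^ i) z" q] dividesD_Irr_of[of "(\<sigma> ^^ j) z" p]
      by (simp add: linked_def \<sigma>n_irreducible)
  qed
  then have "\<not> (\<exists>i j. i \<le> j \<and> j \<le> n \<and> j - i < n \<and>
      assocs R ((\<sigma> ^^ i) z) \<in> Irr_of R q \<and> assocs R ((\<sigma> ^^ j) z) \<in> Irr_of R p)"
    using not_le by blast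
  moreover have "z \<in> carrier R" "ring_irreducible z" "z divides q"
      "(\<sigma> ^^ n) z \<in> carrier R" "ring_irreducible ((\<sigma> ^^ n) z)" "(\<sigma> ^^ n) z divides p"
    using z \<sigma>n_irreducible by (simp_all add: linked_def)
  ultimately have "switch_step R \<sigma> (p, q)
      (\<tau> z \<otimes> quo R p ((\<sigma> ^^ n) z), \<sigma> ((\<sigma> ^^ n) z) \<otimes> quo R q z)"
    unfolding switch_step_def prod.case using assms
    by (intro conjI bexI[of _ z] bexI[of _ "(\<sigma> ^^ n) z"] exI[of _ n]) simp_all
  then show ?thesis by blast
qed

text \<open>The relation \<open>q = \<sigma> (quo R a p)\<close> in a form without quotients, so
  that its preservation is a computation with products.\<close>

definition switch_state :: "'a \<times> 'a \<Rightarrow> bool" where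
  "switch_state = (\<lambda>(p, q). p \<in> carrier R \<and> q \<in> carrier R \<and> p \<otimes> \<tau> q = a)"

lemma switch_state_nonzero:
  assumes "switch_state (p, q)"
  shows "p \<noteq> \<zero>" "q \<noteq> \<zero>"
  using assms a_nonzero \<sigma>_zero_iff[of "\<tau> \<zero>"] by (auto simp: switch_state_def)

lemma switch_stepE:
  assumes "switch_state (p, q)" "switch_step R \<sigma> (p, q) (p', q')"
  obtains z n p1 q1 where "z \<in> carrier R" "ring_irreducible z" "p1 \<in> carrier R" "q1 \<in> carrier R"
    "p = (\<sigma> ^^ n) z \<otimes> p1" "q = z \<otimes> q1" "p' = \<tau> z \<otimes> p1" "q' = (\<sigma> ^^ Suc n) z \<otimes> q1"
proof -
  obtain z n where z: "z \<in> carrier R" "ring_irreducible z" "z divides q" "(\<sigma> ^^ n) z divides p"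
      "p' = \<tau> z \<otimes> quo R p ((\<sigma> ^^ n) z)" "q' = \<sigma> ((\<sigma> ^^ n) z) \<otimes> quo R q z"
    using assms(2) unfolding switch_step_def by blast
  obtain p1 q1 where "p1 \<in> carrier R" "p = (\<sigma> ^^ n) z \<otimes> p1" "q1 \<in> carrier R" "q = z \<otimes> q1"
    using z(3,4) by (auto elim!: dividesE)
  moreover from this have "quo R p ((\<sigma> ^^ n) z) = p1" "quo R q z = q1"
    using z(1) switch_state_nonzero[OF assms(1)] by (auto intro!: quo_eq)
  ultimately show ?thesis
    using that z by simp
qed

lemma switch_state_step:
  assumes "switch_state st" "switch_step R \<sigma> st st'"
  shows "switch_state st'"
proof -
  obtain p q p' q' where [simp]: "st = (p, q)" "st' = (p', q')" by (metis surj_pair)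
  from assms obtain z n p1 q1 where z: "z \<in> carrier R" "p1 \<in> carrier R" "q1 \<in> carrier R"
    "p = (\<sigma> ^^ n) z \<otimes> p1" "q = z \<otimes> q1" "p' = \<tau> z \<otimes> p1" "q' = (\<sigma> ^^ Suc n) z \<otimes> q1"
    by (auto elim: switch_stepE)
  \<comment> \<open>Both sides are the product of \<open>\<tau> z\<close>,
    \<open>(\<sigma> ^^ n) z\<close>, \<open>p1\<close> and \<open>\<tau> q1\<close>.\<close>
  have "p' \<otimes> \<tau> q' = p \<otimes> \<tau> q"
    using z by (simp add: m_ac)
  then show ?thesis
    using assms(1) z by (simp add: switch_state_def)
qed

section \<open>Termination: counting the linked pairs of factors\<close>

definition reaches :: "'a \<Rightarrow> 'a \<Rightarrow> bool" where
  "reaches z w \<longleftrightarrow> (\<exists>n. (\<sigma> ^^ n) z \<sim> w)"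

lemma reaches_assocI: "x \<sim> y \<Longrightarrow> reaches x y"
  unfolding reaches_def by (rule exI[of _ 0]) simp

lemma reaches_\<sigma>n: "x \<in> carrier R \<Longrightarrow> reaches x ((\<sigma> ^^ n) x)"
  unfolding reaches_def by (rule exI[of _ n]) simp

lemma reaches_\<tau>: "x \<in> carrier R \<Longrightarrow> reaches (\<tau> x) x"
  unfolding reaches_def by (rule exI[of _ 1]) simp

lemma reaches_trans [trans]:
  assumes "reaches x y" "reaches y z" "x \<in> carrier R" "y \<in> carrier R" "z \<in> carrier R"
  shows "reaches x z"
proof -
  obtain m n where mn: "(\<sigma> ^^ m) x \<sim> y" "(\<sigma> ^^ n) y \<sim> z"
    using assms(1,2) unfolding reaches_def by blast
  have "(\<sigma> ^^ n) ((\<sigma> ^^ m) x) \<sim> (\<sigma> ^^ n) y"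
    using mn(1) assms by (simp add: \<sigma>n_assoc_iff)
  then have "(\<sigma> ^^ (n + m)) x \<sim> z"
    using associated_trans[OF _ mn(2)] assms by (simp add: funpow_add)
  then show ?thesis unfolding reaches_def by blast
qed

text \<open>One more application of \<sigma> would make \<open>z\<close> associated with a positive
  translate of itself, against the infinite orbits.\<close>

lemma not_reaches_\<tau>:
  assumes z: "z \<in> carrier R" "ring_irreducible z"
  shows "\<not> reaches z (\<tau> z)"
proof
  assume "reaches z (\<tau> z)"
  then obtain m where "(\<sigma> ^^ m) z \<sim> \<tau> z" unfolding reaches_def by blast
  then have "(\<sigma> ^^ 1) ((\<sigma> ^^ m) z) \<sim> (\<sigma> ^^ 1) (\<tau> z)"
    using \<sigma>n_assoc_iff[of "(\<sigma> ^^ m) z" "\<tau> z" 1] z by simp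
  then have "(\<sigma> ^^ Suc m) z \<sim> z"
    using z(1) by simp
  then show False
    using not_assoc_\<sigma>n[OF z, of "Suc m"] by simp
qed

definition weight :: "'a multiset \<Rightarrow> 'a multiset \<Rightarrow> nat" where
  "weight Q P = (\<Sum>z\<in>#Q. size {#w \<in># P. reaches z w#})"

text \<open>
  Replacing \<open>d\<close> by the earlier \<open>\<tau> z\<close> and \<open>c\<close> by the later \<open>(\<sigma> ^^ Suc n) z\<close> creates no new pair, and
  the pair \<open>(c, d)\<close> itself is lost.
\<close>

lemma weight_switch:
  assumes z: "z \<in> carrier R" "ring_irreducible z" and c: "c \<in> carrier R" "z \<sim> c"
    and d: "d \<in> carrier R" "(\<sigma> ^^ n) z \<sim> d"
    and P: "set_mset P \<subseteq> carrier R" and Q: "set_mset Q \<subseteq> carrier R"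
  shows "weight (add_mset ((\<sigma> ^^ Suc n) z) Q) (add_mset (\<tau> z) P)
    < weight (add_mset c Q) (add_mset d P)"
proof -
  let ?N = "\<lambda>y P. size {#w \<in># P. reaches y w#}" and ?z' = "(\<sigma> ^^ Suc n) z"
  have z': "?z' \<in> carrier R" using z(1) by (rule \<sigma>n_closed)
  have "reaches z d"
    using reaches_trans[OF reaches_\<sigma>n reaches_assocI[OF d(2)]] z d(1) by simp
  then have "reaches c d" "reaches (\<tau> z) d"
    using reaches_trans[OF reaches_assocI[OF associated_sym[OF c(2)]]]
      reaches_trans[OF reaches_\<tau>[OF z(1)]] z c d by simp_all
  \<comment> \<open>For an unchanged factor \<open>y\<close> of \<open>q\<close>: as \<tau> z
    precedes \<open>d\<close>, replacing \<open>d\<close> by \<tau> z can only lose pairs.\<close>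
  have "reaches y d" if "y \<in> carrier R" "reaches y (\<tau> z)" for y
    using reaches_trans[OF that(2) \<open>reaches (\<tau> z) d\<close>] that z d by simp
  then have "?N y (add_mset (\<tau> z) P) \<le> ?N y (add_mset d P)" if "y \<in># Q" for y
    using that Q by auto
  then have "(\<Sum>y\<in>#Q. ?N y (add_mset (\<tau> z) P)) \<le> (\<Sum>y\<in>#Q. ?N y (add_mset d P))"
    by (rule sum_mset_mono)
  \<comment> \<open>The new factor of \<open>q\<close> therefore gains nothing from \<tau> z,
    whereas \<open>c\<close> was paired with \<open>d\<close>. This missing pair makes the
    inequality strict.\<close>
  moreover have "\<not> reaches ?z' (\<tau> z)"
    using not_reaches_\<tau>[OF z]
      reaches_trans[OF reaches_\<sigma>n[OF z(1)] _ z(1) z' \<tau>_closed[OF z(1)]] by (rule contrapos_nn)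
  moreover have "reaches c ?z'"
    by (rule reaches_trans[OF reaches_assocI[OF associated_sym[OF c(2)]] reaches_\<sigma>n[OF z(1)] c(1) z(1) z'])
  then have "reaches c x" if "x \<in># P" "reaches ?z' x" for x
    using reaches_trans[OF _ that(2) c(1) z'] that(1) P by blast
  then have "?N ?z' P \<le> ?N c P"
    by (intro size_mset_mono filter_mset_mono_strong) auto
  ultimately show ?thesis
    using \<open>reaches c d\<close> by (simp add: weight_def del: funpow.simps)
qed

text \<open>A relation, because the factors are determined only up to associates; independence of
  the count from their choice need not be shown.\<close>

definition has_weight :: "'a \<times> 'a \<Rightarrow> nat \<Rightarrow> bool" where
  "has_weight = (\<lambda>(p, q) k. \<exists>P Q. irr_factors R P p \<and> irr_factors R Q q \<and> weight Q P = k)"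

lemma has_weight_step:
  assumes "switch_state st" "switch_step R \<sigma> st st'" "has_weight st k"
  shows "\<exists>k'<k. has_weight st' k'"
proof -
  obtain p q p' q' where [simp]: "st = (p, q)" "st' = (p', q')" by (metis surj_pair)
  from assms obtain z n p1 q1 where z: "z \<in> carrier R" "ring_irreducible z"
    "p1 \<in> carrier R" "q1 \<in> carrier R"
    "p = (\<sigma> ^^ n) z \<otimes> p1" "q = z \<otimes> q1" "p' = \<tau> z \<otimes> p1" "q' = (\<sigma> ^^ Suc n) z \<otimes> q1"
    by (auto elim: switch_stepE)
  obtain P Q where PQ: "irr_factors R P p" "irr_factors R Q q" "weight Q P = k"
    using assms(3) by (auto simp: has_weight_def)
  \<comment> \<open>The given multisets contain the switched factors only up to associates;
    \<open>d\<close> and \<open>c\<close> are the members actually removed.\<close>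
  obtain d P1 where P1: "P = add_mset d P1" "(\<sigma> ^^ n) z \<sim> d" "irr_factors R P1 p1"
    using irr_factors_remove[OF PQ(1) \<sigma>n_closed[OF z(1)] \<sigma>n_irreducible[OF z(1,2)] z(3,5)] by blast
  obtain c Q1 where Q1: "Q = add_mset c Q1" "z \<sim> c" "irr_factors R Q1 q1"
    using irr_factors_remove[OF PQ(2) z(1,2,4,6)] by blast
  have "irr_factors R (add_mset (\<tau> z) P1) p'"
    using z P1(3) by (auto intro!: irr_factors.mult \<tau>_irreducible)
  moreover have "irr_factors R (add_mset ((\<sigma> ^^ Suc n) z) Q1) q'"
    unfolding z(8) using z Q1(3) by (intro irr_factors.mult \<sigma>n_irreducible \<sigma>n_closed)
  moreover have "c \<in> carrier R" "d \<in> carrier R" "set_mset P1 \<subseteq> carrier R" "set_mset Q1 \<subseteq> carrier R"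
    using irr_factors_closed[OF PQ(1)] irr_factors_closed[OF PQ(2)] P1(1) Q1(1) by auto
  then have "weight (add_mset ((\<sigma> ^^ Suc n) z) Q1) (add_mset (\<tau> z) P1) < k"
    using weight_switch[OF z(1,2) _ Q1(2) _ P1(2)] PQ(3) P1(1) Q1(1) by blast
  ultimately show ?thesis
    unfolding has_weight_def by auto
qed

lemma has_weight_exists:
  assumes "switch_state st"
  shows "\<exists>k. has_weight st k"
proof -
  obtain p q where st: "st = (p, q)" by (cases st)
  obtain P Q where "irr_factors R P p" "irr_factors R Q q"
    using assms switch_state_nonzero[of p q] irr_factors_exist[of p] irr_factors_exist[of q]
    unfolding st switch_state_def by auto
  then show ?thesis
    unfolding st has_weight_def by auto
qed

lemma no_infinite_switching:
  "\<lbrakk>has_weight (f 0) k; switch_state (f 0)\<rbrakk> \<Longrightarrow> \<exists>i::nat. \<not> switch_step R \<sigma> (f i) (f (Suc i))"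
proof (induction k arbitrary: f rule: less_induct)
  case (less k)
  show ?case
  proof (cases "switch_step R \<sigma> (f 0) (f (Suc 0))")
    case True
    then obtain k' where "k' < k" "has_weight (f (Suc 0)) k'"
      using has_weight_step less.prems by blast
    then show ?thesis
      using less.IH[of k' "\<lambda>i. f (Suc i)"] switch_state_step[OF less.prems(2) True] by blast
  qed blast
qed

lemma switching_stops:
  assumes "switch_state st"
  shows "\<exists>st'. (switch_step R \<sigma>)\<^sup>*\<^sup>* st st' \<and> Omega R \<sigma> st' = {}"
proof -
  have "\<exists>st'. (switch_step R \<sigma>)\<^sup>*\<^sup>* st st' \<and> Omega R \<sigma> st' = {}"
    if "has_weight st k" "switch_state st" for k st
    using that
  proof (induction k arbitrary: st rule: less_induct)
    case (less k)
    show ?case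
    proof (cases "Omega R \<sigma> st = {}")
      case False
      then obtain st1 where st1: "switch_step R \<sigma> st st1"
        using switch_step_exists by (cases st) blast
      then show ?thesis
        using less has_weight_step[OF less.prems(2) st1] switch_state_step[OF less.prems(2) st1]
        by (meson converse_rtranclp_into_rtranclp)
    qed blast
  qed
  then show ?thesis
    using has_weight_exists assms by blast
qed

section \<open>Embeddings between the modules before and after a switch\<close>

text \<open>
  Multiplication by \<open>z \<otimes> \<sigma> z \<otimes> \<dots> \<otimes> (\<sigma> ^^ n) z\<close> will embed the module after a switch into the one before.
\<close>

lemma orbit_product_exists:
  assumes z: "z \<in> carrier R" "z \<noteq> \<zero>"
  shows "\<exists>b\<in>carrier R. b \<noteq> \<zero> \<and> \<tau> b \<otimes> (\<sigma> ^^ n) z = \<tau> z \<otimes> b \<and> \<sigma> b \<otimes> z = b \<otimes> (\<sigma> ^^ Suc n) z"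
proof (induction n)
  case 0
  show ?case using z by (intro bexI[of _ z]) (auto simp: m_comm)
next
  case (Suc n)
  then obtain b where b: "b \<in> carrier R" "b \<noteq> \<zero>" "\<tau> b \<otimes> (\<sigma> ^^ n) z = \<tau> z \<otimes> b"
    "\<sigma> b \<otimes> z = b \<otimes> (\<sigma> ^^ Suc n) z" by blast
  let ?w = "(\<sigma> ^^ n) z"
  have w: "?w \<in> carrier R" "?w \<noteq> \<zero>"
    using z by (simp, induction n) auto
  \<comment> \<open>The product grows by its next translate \<open>\<sigma> ?w\<close>. Under \<tau>
    this becomes \<open>?w\<close>, the factor that the hypothesis on \<open>\<tau> b\<close>
    requires.\<close>
  have "\<tau> (b \<otimes> \<sigma> ?w) \<otimes> \<sigma> ?w = \<tau> z \<otimes> (b \<otimes> \<sigma> ?w)"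
    using b z w by (simp add: m_assoc[symmetric])
  moreover have "\<sigma> (b \<otimes> \<sigma> ?w) \<otimes> z = (\<sigma> b \<otimes> z) \<otimes> \<sigma> (\<sigma> ?w)"
    using b(1) z(1) w by (simp add: m_ac)
  moreover have "b \<otimes> \<sigma> ?w \<noteq> \<zero>"
    using b w by (simp add: integral_iff)
  ultimately show ?case
    using b w by (intro bexI[of _ "b \<otimes> \<sigma> ?w"]) simp_all
qed

text \<open>The equations say that multiplication by \<open>b\<close> commutes with the actions of x
  and y, as a map from the module of the second pair to that of the first;
  \<open>b \<noteq> \<zero>\<close> makes it injective.\<close>

definition embeds :: "'a \<times> 'a \<Rightarrow> 'a \<times> 'a \<Rightarrow> 'a \<Rightarrow> bool" where
  "embeds = (\<lambda>(p, q) (p', q') b. b \<in> carrier R \<and> b \<noteq> \<zero> \<and>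
     \<tau> b \<otimes> p = b \<otimes> p' \<and> \<sigma> b \<otimes> q = b \<otimes> q')"

lemma embeds_step:
  assumes "switch_state st" "switch_step R \<sigma> st st'"
  shows "\<exists>b. embeds st st' b"
proof -
  obtain p q p' q' where [simp]: "st = (p, q)" "st' = (p', q')" by (metis surj_pair)
  from assms obtain z n p1 q1 where z: "z \<in> carrier R" "ring_irreducible z"
    "p1 \<in> carrier R" "q1 \<in> carrier R"
    "p = (\<sigma> ^^ n) z \<otimes> p1" "q = z \<otimes> q1" "p' = \<tau> z \<otimes> p1" "q' = (\<sigma> ^^ Suc n) z \<otimes> q1"
    by (auto elim: switch_stepE)
  obtain b where b: "b \<in> carrier R" "b \<noteq> \<zero>" "\<tau> b \<otimes> (\<sigma> ^^ n) z = \<tau> z \<otimes> b"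
      "\<sigma> b \<otimes> z = b \<otimes> (\<sigma> ^^ Suc n) z"
    using orbit_product_exists ring_irreducibleE(1) z(1,2) by meson
  have "\<tau> b \<otimes> p = (\<tau> b \<otimes> (\<sigma> ^^ n) z) \<otimes> p1"
    using z b(1) by (simp add: m_assoc)
  also have "\<dots> = b \<otimes> p'"
    using z b(1) by (simp add: b(3) m_ac)
  finally have "\<tau> b \<otimes> p = b \<otimes> p'" .
  moreover have "\<sigma> b \<otimes> q = (\<sigma> b \<otimes> z) \<otimes> q1"
    using z b(1) by (simp add: m_assoc)
  then have "\<sigma> b \<otimes> q = b \<otimes> q'"
    using z b(1) by (simp add: b(4) m_assoc)
  ultimately show ?thesis
    using b by (auto simp: embeds_def)
qed

text \<open>Embeddings compose by multiplying their multipliers, starting from \<open>\<one>\<close>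
  when no switch is made.\<close>

lemma switch_steps:
  assumes "(switch_step R \<sigma>)\<^sup>*\<^sup>* st st'" "switch_state st"
  shows "switch_state st' \<and> (\<exists>b. embeds st st' b)"
  using assms
proof (induction rule: rtranclp_induct)
  case base
  have "embeds st st \<one>"
    using base \<tau>_\<sigma>[of \<one>] by (cases st) (auto simp: embeds_def switch_state_def)
  then show ?case using base by blast
next
  case (step st1 st2)
  then obtain b c where "switch_state st1" and bc: "embeds st st1 b" "embeds st1 st2 c"
    using embeds_step by blast
  then have "switch_state st2"
    using switch_state_step step.hyps(2) by blast
  obtain p q p1 q1 p2 q2 where [simp]: "st = (p, q)" "st1 = (p1, q1)" "st2 = (p2, q2)"
    by (metis surj_pair)
  have c: "b \<in> carrier R" "c \<in> carrier R" "p \<in> carrier R" "q \<in> carrier R" "p1 \<in> carrier R"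
    "q1 \<in> carrier R" "p2 \<in> carrier R" "q2 \<in> carrier R"
    using bc step.prems \<open>switch_state st1\<close> \<open>switch_state st2\<close>
    by (auto simp: embeds_def switch_state_def)
  have "\<tau> (b \<otimes> c) \<otimes> p = \<tau> c \<otimes> (\<tau> b \<otimes> p)" "\<sigma> (b \<otimes> c) \<otimes> q = \<sigma> c \<otimes> (\<sigma> b \<otimes> q)"
    using c by (simp_all add: m_ac)
  moreover have "\<tau> c \<otimes> (b \<otimes> p1) = b \<otimes> (\<tau> c \<otimes> p1)" "\<sigma> c \<otimes> (b \<otimes> q1) = b \<otimes> (\<sigma> c \<otimes> q1)"
    using c by (simp_all add: m_lcomm)
  ultimately have "embeds st st2 (b \<otimes> c)"
    using bc c by (auto simp: embeds_def m_assoc integral_iff)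
  then show ?case using \<open>switch_state st2\<close> by blast
qed

end


section \<open>Submodules of the modules attached to divisors\<close>

context gwa_divisor
begin

lemma Vmod_submodule_ideal:
  assumes "submodule N (gwa R \<sigma> a) (Vmod R \<sigma> a p)"
  shows "ideal N R"
proof -
  have sub: "N \<subseteq> carrier R"
    using submodule_subset[OF assms] by simp
  have mult: "r \<otimes> x \<in> N" if "r \<in> carrier R" "x \<in> N" for r x
    using submodule.smult_closed[OF assms, of "cls (Coef r)" x] that sub Vmod_actions(1)[of x r]
    by auto
  show ?thesis
  proof (rule idealI)
    show "subgroup N (add_monoid R)"
    proof (intro subgroup.intro)
      fix x assume x: "x \<in> N"
      then have "\<ominus> x \<in> N"
        using mult[of "\<ominus> \<one>" x] sub l_minus[of \<one> x] by auto
      then show "inv\<^bsub>add_monoid R\<^esub> x \<in> N"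
        by (simp add: a_inv_def)
    qed (use sub submodule_zero[OF assms] submodule_add[OF assms] in auto)
  next
    fix x r assume "x \<in> N" "r \<in> carrier R"
    then show "r \<otimes> x \<in> N" "x \<otimes> r \<in> N"
      using mult[of r x] sub m_comm[of x r] by auto
  qed (rule ring_axioms)
qed

text \<open>The product of nonzero elements, one from each ideal, lies in both and is nonzero in a
  domain.\<close>

lemma Vmod_submodules_meet:
  assumes "submodule N (gwa R \<sigma> a) (Vmod R \<sigma> a p)" "N \<noteq> {\<zero>}"
    and "submodule N' (gwa R \<sigma> a) (Vmod R \<sigma> a p)" "N' \<noteq> {\<zero>}"
  shows "N \<inter> N' \<noteq> {\<zero>}"
proof -
  interpret N: ideal N R by (rule Vmod_submodule_ideal[OF assms(1)])
  interpret N': ideal N' R by (rule Vmod_submodule_ideal[OF assms(3)])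
  obtain r s where rs: "r \<in> N" "r \<noteq> \<zero>" "s \<in> N'" "s \<noteq> \<zero>"
    using assms(2,4) submodule_zero[OF assms(1)] submodule_zero[OF assms(3)] by auto
  then have "r \<in> carrier R" "s \<in> carrier R"
    using N.Icarr N'.Icarr by auto
  then have "r \<otimes> s \<in> N \<inter> N'" "r \<otimes> s \<noteq> \<zero>"
    using rs N.I_r_closed N'.I_l_closed by (auto simp: integral_iff)
  then show ?thesis by blast
qed

lemma Vmod_unique_simple:
  assumes "simple_submodule (gwa R \<sigma> a) (Vmod R \<sigma> a p) S"
    and "simple_submodule (gwa R \<sigma> a) (Vmod R \<sigma> a p) T"
  shows "T = S"
proof -
  have sub: "submodule N (gwa R \<sigma> a) (Vmod R \<sigma> a p)" "N \<noteq> {\<zero>}"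
    if "simple_submodule (gwa R \<sigma> a) (Vmod R \<sigma> a p) N" for N
    using that simple_moduleD(2)[of "gwa R \<sigma> a" "Vmod R \<sigma> a p\<lparr>carrier := N\<rparr>"]
    by (auto simp: simple_submodule_def)
  have "M \<subseteq> N" if "simple_submodule (gwa R \<sigma> a) (Vmod R \<sigma> a p) M"
    "simple_submodule (gwa R \<sigma> a) (Vmod R \<sigma> a p) N" for M N
    using simple_submodule_Int[OF Vmod_left_module that(1) sub(1)[OF that(2)]]
      Vmod_submodules_meet[OF sub[OF that(1)] sub[OF that(2)]] by simp
  then show ?thesis
    using assms by blast
qed

end

section \<open>Simplicity at an output, and the socle\<close>

context gwa_pid
begin

lemma gwa_divisorI: "\<lbrakk>p \<in> carrier R; p divides a\<rbrakk> \<Longrightarrow> gwa_divisor R \<sigma> a p"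
  by (intro gwa_divisor.intro gwa_divisor_axioms.intro gwa_data_axioms domain_axioms a_nonzero)

lemma switch_state_initial:
  assumes "p \<in> carrier R" "p divides a"
  shows "switch_state (p, \<sigma> (quo R a p))"
proof -
  interpret gwa_divisor R \<sigma> a p by (rule gwa_divisorI[OF assms])
  show ?thesis
    using quo_mult by (simp add: switch_state_def)
qed

lemma switch_stateD:
  assumes "switch_state (p, q)"
  shows "p \<in> carrier R" "p divides a" "q = \<sigma> (quo R a p)"
proof -
  have pq: "p \<in> carrier R" "q \<in> carrier R" "a = p \<otimes> \<tau> q"
    using assms by (auto simp: switch_state_def)
  then show "p \<in> carrier R" "p divides a"
    by (auto intro: dividesI)
  show "q = \<sigma> (quo R a p)"
    using pq quo_eq[of p "\<tau> q"] switch_state_nonzero[OF assms] by simp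
qed

text \<open>Linearity is checked on terms, where only the generators x and y use the equations of
  \<open>embeds\<close>; coefficients act by multiplication and the ring operations inherit the
  property.\<close>

lemma gwa_act_embeds:
  assumes "switch_state (p, q)" "switch_state (p', q')" "embeds (p, q) (p', q') b"
    and "t \<in> gwa_terms R" "r \<in> carrier R"
  shows "gwa_act R \<sigma> p q t (r \<otimes> b) = gwa_act R \<sigma> p' q' t r \<otimes> b"
proof -
  have c: "b \<in> carrier R" "p \<in> carrier R" "q \<in> carrier R" "p' \<in> carrier R" "q' \<in> carrier R"
    and b: "\<tau> b \<otimes> p = b \<otimes> p'" "\<sigma> b \<otimes> q = b \<otimes> q'"
    using assms(1-3) by (auto simp: switch_state_def embeds_def)
  show ?thesis
    using assms(4,5)
  proof (induction t arbitrary: r)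
    case GenX
    then show ?case using b(1) c by (simp add: m_assoc) (simp add: m_ac)
  next
    case GenY
    then show ?case using b(2) c by (simp add: m_assoc) (simp add: m_ac)
  qed (use c in \<open>simp_all add: m_assoc l_distr l_minus gwa_act_closed\<close>)
qed

text \<open>
  A submodule is an ideal \<open>(b)\<close> with \<open>b\<close> dividing both \<open>\<tau> b \<otimes> p\<close> and \<open>\<sigma> b \<otimes> q\<close>. On the orbit of an
  irreducible factor of \<open>b\<close>, the last factor of \<open>b\<close> must divide \<open>p\<close> and the first one must divide \<open>q\<close>.
\<close>

lemma unit_if_Omega_empty:
  assumes pq: "p \<in> carrier R" "q \<in> carrier R" and Omega: "Omega R \<sigma> (p, q) = {}"
    and b: "b \<in> carrier R" "b \<noteq> \<zero>" "b divides \<tau> b \<otimes> p" "b divides \<sigma> b \<otimes> q"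
  shows "b \<in> Units R"
proof (rule ccontr)
  assume "b \<notin> Units R"
  then obtain z where z: "z \<in> carrier R" "ring_irreducible z" "z divides b"
    using exists_irreducible_divisor[of b] b by blast
  \<comment> \<open>Since \<open>z\<close> itself divides \<open>b\<close>, the first forward
    translate that fails to divide has a predecessor, with exponent \<open>m\<close>. It ends the
    unbroken run starting at \<open>z\<close>; later translates may divide \<open>b\<close> again,
    but only the failure right after the run matters. Backwards the same holds with
    \<open>k\<close>.\<close>
  obtain m where m: "(\<sigma> ^^ m) z divides b" "\<not> \<sigma> ((\<sigma> ^^ m) z) divides b"
    using not_all_\<sigma>n_divide[OF z(1,2) b(1,2)] z(3)
      ex_least_nat_less[of "\<lambda>m. \<not> (\<sigma> ^^ m) z divides b"] by auto (meson order_refl)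
  obtain k where k: "(\<tau> ^^ k) z divides b" "\<not> \<tau> ((\<tau> ^^ k) z) divides b"
    using not_all_\<tau>n_divide[OF z(1,2) b(1,2)] z(3)
      ex_least_nat_less[of "\<lambda>k. \<not> (\<tau> ^^ k) z divides b"] by auto (meson order_refl)
  have "(\<sigma> ^^ m) z divides \<tau> b \<otimes> p" "(\<tau> ^^ k) z divides \<sigma> b \<otimes> q"
    using divides_trans[OF m(1) b(3)] divides_trans[OF k(1) b(4)] z(1) by simp_all
  \<comment> \<open>Dividing \<open>\<tau> b\<close> would mean, after applying \<sigma>, that the
    next translate divides \<open>b\<close>.\<close>
  moreover have "\<not> (\<sigma> ^^ m) z divides \<tau> b"
    using m(2) \<sigma>_divides[of "(\<sigma> ^^ m) z" "\<tau> b"] z(1) b(1) by auto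
  moreover have "\<not> (\<tau> ^^ k) z divides \<sigma> b"
    using k(2) \<tau>_divides[of "(\<tau> ^^ k) z" "\<sigma> b"] z(1) b(1) by auto
  ultimately have "(\<sigma> ^^ m) z divides p" "(\<tau> ^^ k) z divides q"
    using irreducible_dvd_mult[OF \<sigma>n_closed[OF z(1)] \<sigma>n_irreducible[OF z(1,2)]]
      irreducible_dvd_mult[OF \<tau>n_closed[OF z(1)] \<tau>n_irreducible[OF z(1,2)]] b(1) pq by (meson \<tau>_closed \<sigma>_closed)+
  \<comment> \<open>The start of the run divides \<open>q\<close> and reaches its end, a divisor of
    \<open>p\<close>, in \<open>m + k\<close> steps: a pair that \<open>Omega\<close> should not
    contain.\<close>
  moreover have "(\<sigma> ^^ (m + k)) ((\<tau> ^^ k) z) = (\<sigma> ^^ m) z"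
    using z(1) by (simp add: funpow_add)
  ultimately have "(\<sigma> ^^ (m + k)) ((\<tau> ^^ k) z) divides p" "(\<tau> ^^ k) z divides q" by simp_all
  then show False
    using Omega Omega_nonempty_iff[of p q] \<tau>n_closed[OF z(1)] \<tau>n_irreducible[OF z(1,2)] by blast
qed

lemma simple_Vmod:
  assumes p: "p \<in> carrier R" "p divides a" and Omega: "Omega R \<sigma> (p, \<sigma> (quo R a p)) = {}"
  shows "simple_module (gwa R \<sigma> a) (Vmod R \<sigma> a p)"
proof -
  interpret gwa_divisor R \<sigma> a p by (rule gwa_divisorI[OF p])
  have "N = {\<zero>} \<or> N = carrier R" if N: "submodule N (gwa R \<sigma> a) (Vmod R \<sigma> a p)" for N
  proof (cases "N = {\<zero>}")
    case False
    have ideal: "ideal N R" by (rule Vmod_submodule_ideal[OF N])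
    then obtain b where b: "b \<in> carrier R" "N = PIdl b"
      using exists_gen by blast
    have b0: "b \<noteq> \<zero>"
      using False b genideal_zero cgenideal_eq_genideal[of \<zero>] by auto
    have dvd: "b divides r" if "r \<in> N" for r
      using that b by (auto simp: cgenideal_def m_comm intro: dividesI)
    have "b \<in> N"
      using b cgenideal_self by blast
    \<comment> \<open>Letting x and y act on the generator of the ideal yields the two
      divisibilities.\<close>
    then have "\<tau> b \<otimes> p \<in> N" "\<sigma> b \<otimes> \<sigma> (quo R a p) \<in> N"
      using submodule.smult_closed[OF N, of "cls GenX" b] submodule.smult_closed[OF N, of "cls GenY" b]
        Vmod_actions(2,3)[OF b(1) b(1)] by simp_all
    then have "b \<in> Units R"
      using unit_if_Omega_empty[OF _ _ Omega b(1) b0] dvd by simp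
    then show ?thesis
      using ideal_eq_carrier_iff[OF b(1)] b(2) by simp
  qed blast
  moreover have "carrier R \<noteq> {\<zero>}"
    using one_not_zero one_closed by blast
  ultimately show ?thesis
    unfolding simple_module_def using Vmod_left_module by simp
qed

lemma output_embeds:
  assumes p: "p \<in> carrier R" "p divides a" and out: "switching_output R \<sigma> a p p'"
  shows "p' \<in> carrier R \<and> p' divides a \<and>
    (\<exists>S. simple_submodule (gwa R \<sigma> a) (Vmod R \<sigma> a p) S \<and>
       module_isomorphic (gwa R \<sigma> a) ((Vmod R \<sigma> a p)\<lparr>carrier := S\<rparr>) (Vmod R \<sigma> a p'))"
proof -
  let ?q = "\<sigma> (quo R a p)"
  obtain q' where q': "(switch_step R \<sigma>)\<^sup>*\<^sup>* (p, ?q) (p', q')" "Omega R \<sigma> (p', q') = {}"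
    using out by (auto simp: switching_output_def)
  obtain b where state: "switch_state (p', q')" and b: "embeds (p, ?q) (p', q') b"
    using switch_steps[OF q'(1) switch_state_initial[OF p]] by blast
  note p' = switch_stateD[OF state]
  interpret V: gwa_divisor R \<sigma> a p by (rule gwa_divisorI[OF p])
  interpret V': gwa_divisor R \<sigma> a p' by (rule gwa_divisorI[OF p'(1,2)])
  let ?f = "\<lambda>r. r \<otimes> b"
  have b_closed: "b \<in> carrier R" "b \<noteq> \<zero>"
    using b by (auto simp: embeds_def)
  have inj: "inj_on ?f (carrier (Vmod R \<sigma> a p'))"
    using m_rcancel[OF b_closed(2,1)] by (intro inj_onI) simp
  have smult: "?f (T \<odot>\<^bsub>Vmod R \<sigma> a p'\<^esub> r) = T \<odot>\<^bsub>Vmod R \<sigma> a p\<^esub> ?f r"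
    if T: "T \<in> carrier (gwa R \<sigma> a)" "r \<in> carrier (Vmod R \<sigma> a p')" for T r
  proof -
    obtain t where "t \<in> gwa_terms R" "T = cls t"
      using T(1) by (auto simp: gwa_carrier)
    then show ?thesis
      using gwa_act_embeds[OF switch_state_initial[OF p] state b, of t r] T(2) b_closed(1) p'(3)
      by (simp add: V.Vmod_smult V'.Vmod_smult)
  qed
  \<comment> \<open>The two placeholders stand for closedness and additivity of \<open>?f\<close>,
    which remain as subgoals at each use.\<close>
  note hom = V.Vmod_left_module V'.Vmod_left_module _ inj _ smult
  have "simple_submodule (gwa R \<sigma> a) (Vmod R \<sigma> a p) (?f ` carrier (Vmod R \<sigma> a p'))"
    using simple_Vmod[OF p'(1,2)] q'(2) p'(3) b_closed
    by (intro simple_submodule_hom_image[OF hom]) (simp_all add: l_distr)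
  moreover have "module_isomorphic (gwa R \<sigma> a)
      ((Vmod R \<sigma> a p)\<lparr>carrier := ?f ` carrier (Vmod R \<sigma> a p')\<rparr>) (Vmod R \<sigma> a p')"
    using b_closed by (intro hom_image_isomorphic[OF hom]) (simp_all add: l_distr)
  ultimately show ?thesis
    using p' by blast
qed

lemma switching_terminates:
  assumes "p \<in> carrier R" "p divides a"
  shows "switching_terminates R \<sigma> a p"
  unfolding switching_terminates_def
  using no_infinite_switching has_weight_exists switch_state_initial[OF assms] switch_step_exists
  by (metis surj_pair)

lemma switching_output_exists:
  assumes "p \<in> carrier R" "p divides a"
  shows "\<exists>p'. switching_output R \<sigma> a p p'"
  using switching_stops[OF switch_state_initial[OF assms]] by (auto simp: switching_output_def)

end

theorem corollary3p8:
  fixes R :: "('a, 'm) ring_scheme" and \<sigma> :: "'a \<Rightarrow> 'a" and a p :: 'a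
  assumes "principal_domain R"
    and "\<sigma> \<in> ring_iso R R"
    and "a \<in> carrier R" and "a \<noteq> \<zero>\<^bsub>R\<^esub>"
    and "\<forall>z\<in>Irr R. infinite (aut_orbit R \<sigma> z)"
    and "p \<in> carrier R" and "p divides\<^bsub>R\<^esub> a"
  shows "switching_terminates R \<sigma> a p \<and>
    (\<exists>p'. switching_output R \<sigma> a p p') \<and>
    (\<exists>!S. simple_submodule (gwa R \<sigma> a) (Vmod R \<sigma> a p) S) \<and>
    simple_submodule (gwa R \<sigma> a) (Vmod R \<sigma> a p) (socle (gwa R \<sigma> a) (Vmod R \<sigma> a p)) \<and>
    (\<forall>p'. switching_output R \<sigma> a p p' \<longrightarrow>
       p' \<in> carrier R \<and> p' divides\<^bsub>R\<^esub> a \<and>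
       module_isomorphic (gwa R \<sigma> a)
         ((Vmod R \<sigma> a p)\<lparr>carrier := socle (gwa R \<sigma> a) (Vmod R \<sigma> a p)\<rparr>)
         (Vmod R \<sigma> a p'))"
proof -
  interpret principal_domain R by fact
  interpret gwa_pid R \<sigma> a
    using assms by unfold_locales auto
  interpret gwa_divisor R \<sigma> a p
    by (rule gwa_divisorI[OF assms(6,7)])
  obtain p' where "switching_output R \<sigma> a p p'"
    using switching_output_exists[OF assms(6,7)] by blast
  then obtain S where S: "simple_submodule (gwa R \<sigma> a) (Vmod R \<sigma> a p) S"
    using output_embeds[OF assms(6,7)] by blast
  \<comment> \<open>\<open>S\<close> was found from one particular output; by uniqueness the simple
    submodules coming from all other outputs coincide with it, which gives the isomorphism for
    arbitrary \<open>p'\<close>.\<close>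
  then have "socle (gwa R \<sigma> a) (Vmod R \<sigma> a p) = S"
    using socle_unique_simple Vmod_unique_simple by blast
  then show ?thesis
    using S Vmod_unique_simple switching_terminates[OF assms(6,7)]
      switching_output_exists[OF assms(6,7)] output_embeds[OF assms(6,7)] by metis
qed

end
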